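(* Let $\alpha_0=1$, $\beta_0=0$, and $\alpha_n=0$, $\beta_n=1$ for all $n\ge1$. Let $\psi$ be an arbitrary state on $M_2(\mathbb C)$, with parameters $0\le\lambda\le1$ and $\zeta\in\mathbb C$, $|\zeta|\le1$, and let $T_\psi$ be the associated transition operator on $\mathcal B(\mathcal H)$, $\mathcal H=\ell^2(\mathbb N)$. Then $T_\psi$ admits an invariant normal state $\varphi$ on $\mathcal B(\mathcal H)$ if and only if $\lambda<\frac12$. In this case $\varphi$ is given by $$\overline{\varphi(e_{n+k,n})}=\varphi(e_{n,n+k})=\frac{1-2\lambda}{1-\lambda}\left(i\bar\zeta\sqrt{\frac{\lambda}{1-\lambda}}\right)^{k}\left(\frac{\lambda}{1-\lambda}\right)^{n}\qquad(n,k\in\mathbb N).$$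
   Context: $\mathbb N$ includes $0$, and $0^0=1$. $\mathcal H=\ell^2(\mathbb N)$ has canonical orthonormal basis $(e_n)_{n\in\mathbb N}$; scalar products are linear in the first component; $e_{m,n}$ is the matrix unit $e_{m,n}\xi=\langle\xi,e_n\rangle e_m$; $\mathbf 1$ is the identity operator. Let $a,b\in\mathcal B(\mathcal H)$ be the diagonal operators $a e_n=\alpha_n e_n$, $b e_n=\beta_n e_n$, and let $s$ be the isometric shift $s e_n=e_{n+1}$. Writing operators on $\mathcal H\otimes\mathbb C^2$ as $2\times2$ matrices with entries in $\mathcal B(\mathcal H)$ (so $x\otimes y=(y_{i,j}x)_{i,j}$), define the unitary $$u=\begin{pmatrix} s^*as & i s^*b\\ i bs & a\end{pmatrix}.$$ For a state $\psi$ on $M_2=M_2(\mathbb C)$ let $P_\psi:\mathcal B(\mathcal H\otimes\mathbb C^2)\to\mathcal B(\mathcal H)$ be the linear extension of $P_\psi(x\otimes y)=\psi(y)x$. The transition operator associated with $\psi$ is $T_\psi(x)=P_\psi\bigl(u^*(x\otimes\mathbf 1)u\bigr)$, $x\in\mathcal B(\mathcal H)$. Every state $\psi$ on $M_2$ is of the form $\psi(y)=\mathrm{Tr}(\rho y)$ with $$\rho=\begin{pmatrix}\lambda & \bar\zeta\sqrt{\lambda(1-\lambda)}\\ \zeta\sqrt{\lambda(1-\lambda)} & 1-\lambda\end{pmatrix},\qquad 0\le\lambda\le1,\ |\zeta|\le1,$$ with the convention $\zeta:=0$ if $\lambda\in\{0,1\}$; these $\lambda,\zeta$ are the parameters of $\psi$.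 A state on $\mathcal B(\mathcal H)$ is normal if it has the form $\mathrm{Tr}(\sigma\,\cdot\,)$ with $\sigma$ trace class; it is invariant for $T_\psi$ if $\varphi\circ T_\psi=\varphi$. *)

theory Defs
  imports "HOL-Analysis.Analysis"
begin

section \<open>The Hilbert space $\ell^2(\mathbb N)$\<close>

typedef ell2 = "{x :: nat \<Rightarrow> complex. summable (\<lambda>n. (cmod (x n))\<^sup>2)}"
  morphisms coord Abs_ell2
  by (rule exI[of _ "\<lambda>_. 0"]) simp

setup_lifting type_definition_ell2

lemma ell2_eqI: "(\<And>n. coord x n = coord y n) \<Longrightarrow> x = y"
  by (simp add: coord_inject[symmetric] fun_eq_iff)

lemma summable_sq_add:
  fixes x y :: "nat \<Rightarrow> complex"
  assumes "summable (\<lambda>n. (cmod (x n))\<^sup>2)" "summable (\<lambda>n. (cmod (y n))\<^sup>2)"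
  shows "summable (\<lambda>n. (cmod (x n + y n))\<^sup>2)"
proof (rule summable_comparison_test')
  show "summable (\<lambda>n. 2 * (cmod (x n))\<^sup>2 + 2 * (cmod (y n))\<^sup>2)"
    using assms by (intro summable_add summable_mult)
  fix n
  have "(cmod (x n + y n))\<^sup>2 \<le> (cmod (x n) + cmod (y n))\<^sup>2"
    by (intro power_mono norm_triangle_ineq) auto
  also have "\<dots> \<le> 2 * (cmod (x n))\<^sup>2 + 2 * (cmod (y n))\<^sup>2"
    using sum_squares_bound[of "cmod (x n)" "cmod (y n)"]
    by (simp add: power2_eq_square algebra_simps)
  finally show "norm ((cmod (x n + y n))\<^sup>2) \<le> 2 * (cmod (x n))\<^sup>2 + 2 * (cmod (y n))\<^sup>2" by simp
qed

lemma summable_sq_scale: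
  fixes x :: "nat \<Rightarrow> complex"
  assumes "summable (\<lambda>n. (cmod (x n))\<^sup>2)"
  shows "summable (\<lambda>n. (cmod (c * x n))\<^sup>2)"
  using summable_mult[OF assms, of "(cmod c)\<^sup>2"] by (simp add: norm_mult power_mult_distrib)

lemma summable_sq_prod:
  fixes x y :: "nat \<Rightarrow> complex"
  assumes "summable (\<lambda>n. (cmod (x n))\<^sup>2)" "summable (\<lambda>n. (cmod (y n))\<^sup>2)"
  shows "summable (\<lambda>n. cmod (x n * cnj (y n)))"
proof (rule summable_comparison_test')
  show "summable (\<lambda>n. (cmod (x n))\<^sup>2 + (cmod (y n))\<^sup>2)" using assms by (rule summable_add)
  fix n
  have "0 \<le> cmod (x n) * cmod (y n)" by simp
  then have "cmod (x n) * cmod (y n) \<le> (cmod (x n))\<^sup>2 + (cmod (y n))\<^sup>2"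
    using sum_squares_bound[of "cmod (x n)" "cmod (y n)"] by linarith
  then show "norm (cmod (x n * cnj (y n))) \<le> (cmod (x n))\<^sup>2 + (cmod (y n))\<^sup>2"
    by (simp add: norm_mult)
qed

instantiation ell2 :: real_vector
begin
lift_definition zero_ell2 :: ell2 is "\<lambda>_. 0" by simp
lift_definition plus_ell2 :: "ell2 \<Rightarrow> ell2 \<Rightarrow> ell2" is "\<lambda>x y n. x n + y n"
  by (rule summable_sq_add)
lift_definition uminus_ell2 :: "ell2 \<Rightarrow> ell2" is "\<lambda>x n. - x n" by simp
lift_definition minus_ell2 :: "ell2 \<Rightarrow> ell2 \<Rightarrow> ell2" is "\<lambda>x y n. x n - y n"
  using summable_sq_add[of _ "\<lambda>n. - y n" for y] by simp
lift_definition scaleR_ell2 :: "real \<Rightarrow> ell2 \<Rightarrow> ell2" is "\<lambda>r x n. r *\<^sub>R x n"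
  using summable_sq_scale by (simp add: scaleR_conv_of_real)
instance
  by standard (transfer; auto simp: fun_eq_iff algebra_simps)+
end

lift_definition scaleC :: "complex \<Rightarrow> ell2 \<Rightarrow> ell2" (infixr \<open>*\<^sub>C\<close> 75)
  is "\<lambda>c x n. c * x n"
  by (rule summable_sq_scale)

lift_definition ket :: "nat \<Rightarrow> ell2" is "\<lambda>k n. if n = k then 1 else 0"
proof -
  fix k :: nat
  show "summable (\<lambda>n. (cmod (if n = k then 1 else 0))\<^sup>2)"
    by (rule summable_finite[of "{k}"]) auto
qed

text \<open>The scalar product is linear in the first argument.\<close>

definition cinner :: "ell2 \<Rightarrow> ell2 \<Rightarrow> complex"
  where "cinner x y = (\<Sum>n. coord x n * cnj (coord y n))"

lemma coord_sq_summable: "summable (\<lambda>n. (cmod (coord x n))\<^sup>2)"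
  using coord[of x] by simp

lemma cinner_summable: "summable (\<lambda>n. coord x n * cnj (coord y n))"
  by (rule summable_norm_cancel) (rule summable_sq_prod[OF coord_sq_summable coord_sq_summable])

lemma coord_simps [simp]:
  "coord 0 n = 0" "coord (x + y) n = coord x n + coord y n" "coord (- x) n = - coord x n"
  "coord (x - y) n = coord x n - coord y n" "coord (r *\<^sub>R x) n = of_real r * coord x n"
  "coord (c *\<^sub>C x) n = c * coord x n" "coord (ket k) n = (if n = k then 1 else 0)"
  by (simp_all add: zero_ell2.rep_eq plus_ell2.rep_eq uminus_ell2.rep_eq minus_ell2.rep_eq
      scaleR_ell2.rep_eq scaleC.rep_eq ket.rep_eq scaleR_conv_of_real)

lemma cinner_sums: "(\<lambda>n. coord x n * cnj (coord y n)) sums cinner x y"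
  unfolding cinner_def by (rule summable_sums[OF cinner_summable])

lemma cinner_add_left: "cinner (x + y) z = cinner x z + cinner y z"
  using sums_unique2[OF cinner_sums[of "x + y" z] ] sums_add[OF cinner_sums[of x z] cinner_sums[of y z]]
  by (simp add: algebra_simps)

lemma cinner_scaleC_left: "cinner (c *\<^sub>C x) y = c * cinner x y"
  using sums_unique2[OF cinner_sums[of "c *\<^sub>C x" y] ] sums_mult[OF cinner_sums[of x y], of c]
  by (simp add: algebra_simps)

lemma cinner_commute: "cinner x y = cnj (cinner y x)"
  using sums_unique2[OF cinner_sums[of x y]] cinner_sums[of y x, THEN sums_cnj[THEN iffD2]]
  by (simp add: algebra_simps)

lemma scaleC_of_real: "of_real r *\<^sub>C x = r *\<^sub>R x"
  by (rule ell2_eqI) simp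

lemma cinner_self_sums: "(\<lambda>n. (cmod (coord x n))\<^sup>2) sums Re (cinner x x)"
  using sums_Re[OF cinner_sums[of x x]] by (simp add: complex_norm_square[symmetric] del: of_real_power)

instantiation ell2 :: real_inner
begin
definition inner_ell2 :: "ell2 \<Rightarrow> ell2 \<Rightarrow> real" where "inner_ell2 x y = Re (cinner x y)"
definition norm_ell2 :: "ell2 \<Rightarrow> real" where "norm_ell2 x = sqrt (Re (cinner x x))"
definition sgn_ell2 :: "ell2 \<Rightarrow> ell2" where "sgn_ell2 x = inverse (norm x) *\<^sub>R x"
definition dist_ell2 :: "ell2 \<Rightarrow> ell2 \<Rightarrow> real" where "dist_ell2 x y = norm (x - y)"
definition uniformity_ell2 :: "(ell2 \<times> ell2) filter"
  where "uniformity_ell2 = (INF e\<in>{0<..}. principal {(x, y). dist x y < e})"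
definition open_ell2 :: "ell2 set \<Rightarrow> bool"
  where "open_ell2 U = (\<forall>x\<in>U. \<forall>\<^sub>F (x', y) in uniformity. x' = x \<longrightarrow> y \<in> U)"
instance
proof
  fix x y z :: ell2 and r :: real and U :: "ell2 set"
  show "sgn x = x /\<^sub>R norm x" by (simp add: sgn_ell2_def)
  show "dist x y = norm (x - y)" by (rule dist_ell2_def)
  show "uniformity = (INF e\<in>{0<..}. principal {(x :: ell2, y). dist x y < e})"
    by (rule uniformity_ell2_def)
  show "open U = (\<forall>x\<in>U. \<forall>\<^sub>F (x', y) in uniformity. x' = x \<longrightarrow> y \<in> U)"
    by (rule open_ell2_def)
  show "inner x y = inner y x"
    unfolding inner_ell2_def by (subst cinner_commute) simp
  show "inner (x + y) z = inner x z + inner y z"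
    by (simp add: inner_ell2_def cinner_add_left)
  show "inner (r *\<^sub>R x) y = r * inner x y"
    by (simp add: inner_ell2_def scaleC_of_real[symmetric] cinner_scaleC_left)
  show "0 \<le> inner x x"
    using sums_le[OF _ sums_zero cinner_self_sums[of x]] by (simp add: inner_ell2_def)
  show "inner x x = 0 \<longleftrightarrow> x = 0"
  proof
    assume "inner x x = 0"
    then have "(\<Sum>n. (cmod (coord x n))\<^sup>2) = 0"
      using sums_unique[OF cinner_self_sums[of x]] by (simp add: inner_ell2_def)
    then have "\<forall>n. (cmod (coord x n))\<^sup>2 = 0"
      using suminf_eq_zero_iff[OF coord_sq_summable, of x] by simp
    then show "x = 0" by (intro ell2_eqI) simp
  qed (simp add: inner_ell2_def cinner_def)
  show "norm x = sqrt (inner x x)" by (simp add: norm_ell2_def inner_ell2_def)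
qed
end

lemma norm_sq_sums: "(\<lambda>n. (cmod (coord x n))\<^sup>2) sums (norm x)\<^sup>2"
  using cinner_self_sums[of x] inner_ge_zero[of x] by (simp add: norm_ell2_def inner_ell2_def)

lemma norm_scaleC: "norm (c *\<^sub>C x) = cmod c * norm x"
proof -
  have "(norm (c *\<^sub>C x))\<^sup>2 = (cmod c * norm x)\<^sup>2"
    using sums_unique2[OF norm_sq_sums[of "c *\<^sub>C x"]] sums_mult[OF norm_sq_sums[of x], of "(cmod c)\<^sup>2"]
    by (simp add: norm_mult power_mult_distrib)
  then show ?thesis by (rule power2_eq_imp_eq) auto
qed

lemma cinner_ket_right: "cinner x (ket n) = coord x n"
  unfolding cinner_def by (subst suminf_finite[of "{n}"]) auto

lemma cmod_coord_le: "cmod (coord x n) \<le> norm x"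
proof -
  have "(cmod (coord x n))\<^sup>2 \<le> (norm x)\<^sup>2"
    using sum_le_suminf[OF coord_sq_summable[of x], of "{n}"] sums_unique[OF norm_sq_sums[of x]] by simp
  then show ?thesis by (rule power2_le_imp_le) simp
qed

lemma norm_ket [simp]: "norm (ket n) = 1"
proof -
  have "(\<lambda>m. (cmod (coord (ket n) m))\<^sup>2) sums (\<Sum>m\<in>{n}. (cmod (coord (ket n) m))\<^sup>2)"
    by (rule sums_finite) auto
  then have "(norm (ket n))\<^sup>2 = 1" using sums_unique2[OF norm_sq_sums[of "ket n"]] by force
  then show ?thesis by (rule power2_eq_imp_eq[of _ 1, unfolded one_power2]) auto
qed

lemma norm_le_by_coords:
  assumes "\<And>n. cmod (coord y n) \<le> cmod (coord x n) * K" "0 \<le> K"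
  shows "norm y \<le> norm x * K"
proof -
  have "(cmod (coord y n))\<^sup>2 \<le> (cmod (coord x n))\<^sup>2 * K\<^sup>2" for n
    using power_mono[OF assms(1)[of n] norm_ge_zero, of 2] by (simp add: power_mult_distrib)
  then have "(norm y)\<^sup>2 \<le> (norm x * K)\<^sup>2"
    unfolding power_mult_distrib
    by (rule sums_le[OF _ norm_sq_sums[of y] sums_mult2[OF norm_sq_sums[of x], of "K\<^sup>2"]])
  then show ?thesis by (rule power2_le_imp_le) (use assms in simp)
qed

section \<open>Bounded operators\<close>

typedef bop = "{f :: ell2 \<Rightarrow> ell2. bounded_linear f \<and> (\<forall>c x. f (c *\<^sub>C x) = c *\<^sub>C f x)}"
  morphisms app Abs_bop
  by (rule exI[of _ "\<lambda>x. x"]) simp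

setup_lifting type_definition_bop

lemma bop_eqI: "(\<And>x. app S x = app R x) \<Longrightarrow> S = R"
  by (simp add: app_inject[symmetric] fun_eq_iff)

lemma scaleC_algebra:
  "c *\<^sub>C (x + y) = c *\<^sub>C x + c *\<^sub>C y" "c *\<^sub>C (x - y) = c *\<^sub>C x - c *\<^sub>C y"
  "c *\<^sub>C (- x) = - (c *\<^sub>C x)" "c *\<^sub>C (0 :: ell2) = 0" "c *\<^sub>C d *\<^sub>C x = (c * d) *\<^sub>C x"
  "(c + d) *\<^sub>C x = c *\<^sub>C x + d *\<^sub>C x" "c *\<^sub>C (r *\<^sub>R x) = r *\<^sub>R (c *\<^sub>C x)"
  by (auto intro!: ell2_eqI simp: algebra_simps)

lemma bounded_linear_scaleC: "bounded_linear (\<lambda>x. c *\<^sub>C x)"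
  by (rule bounded_linear_intro[of _ "cmod c"]) (simp_all add: scaleC_algebra norm_scaleC)

text \<open>Multiplication of operators is composition, so that matrices over \<open>bop\<close> can be multiplied
  with the library's \<open>**\<close>.\<close>

instantiation bop :: ring_1
begin
lift_definition zero_bop :: bop is "\<lambda>_. 0" by (simp add: scaleC_algebra)
lift_definition one_bop :: bop is "\<lambda>x. x" by simp
lift_definition plus_bop :: "bop \<Rightarrow> bop \<Rightarrow> bop" is "\<lambda>f g x. f x + g x"
  by (auto intro: bounded_linear_add simp: scaleC_algebra)
lift_definition uminus_bop :: "bop \<Rightarrow> bop" is "\<lambda>f x. - f x"
  by (auto intro: bounded_linear_minus simp: scaleC_algebra)
lift_definition minus_bop :: "bop \<Rightarrow> bop \<Rightarrow> bop" is "\<lambda>f g x. f x - g x"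
  by (auto intro: bounded_linear_sub simp: scaleC_algebra)
lift_definition times_bop :: "bop \<Rightarrow> bop \<Rightarrow> bop" is "\<lambda>f g x. f (g x)"
  by (auto intro: bounded_linear_compose)
instance
proof
  fix a b c :: bop
  have add: "app a (x + y) = app a x + app a y" for x y
    using app[of a] by (simp add: linear_simps)
  show "a * (b + c) = a * b + a * c"
    by (rule bop_eqI) (simp add: times_bop.rep_eq plus_bop.rep_eq add)
  show "(0 :: bop) \<noteq> 1"
  proof
    assume "(0 :: bop) = 1"
    then have "ket 0 = 0"
      by (metis one_bop.rep_eq zero_bop.rep_eq)
    then show False by (metis norm_ket norm_zero zero_neq_one)
  qed
qed (transfer; simp add: fun_eq_iff algebra_simps)+
end

lift_definition scaleC_op :: "complex \<Rightarrow> bop \<Rightarrow> bop" (infixr \<open>*\<^sub>O\<close> 75)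
  is "\<lambda>c f x. c *\<^sub>C f x"
  by (auto intro: bounded_linear_compose[OF bounded_linear_scaleC] simp: scaleC_algebra mult.commute)

text \<open>The value \<open>0\<close> for unbounded \<open>\<alpha>\<close> is junk.\<close>

lift_definition diag_op :: "(nat \<Rightarrow> complex) \<Rightarrow> bop"
  is "\<lambda>\<alpha> x. if bounded (range \<alpha>) then Abs_ell2 (\<lambda>n. \<alpha> n * coord x n) else 0"
proof -
  fix \<alpha> :: "nat \<Rightarrow> complex"
  let ?f = "\<lambda>x. if bounded (range \<alpha>) then Abs_ell2 (\<lambda>n. \<alpha> n * coord x n) else 0"
  show "bounded_linear ?f \<and> (\<forall>c x. ?f (c *\<^sub>C x) = c *\<^sub>C ?f x)"
  proof (cases "bounded (range \<alpha>)")
    case True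
    then obtain K where K: "\<And>n. cmod (\<alpha> n) \<le> K" by (auto simp: bounded_iff)
    have K0: "0 \<le> K" using K[of 0] norm_ge_zero order_trans by blast
    have le: "cmod (\<alpha> n * coord x n) \<le> cmod (coord x n) * K" for x n
      using mult_right_mono[OF K, of "cmod (coord x n)" n] by (simp add: norm_mult mult.commute)
    have "summable (\<lambda>n. (cmod (\<alpha> n * coord x n))\<^sup>2)" for x
    proof (rule summable_comparison_test')
      show "summable (\<lambda>n. (cmod (coord x n))\<^sup>2 * K\<^sup>2)"
        by (rule summable_mult2[OF coord_sq_summable])
      show "norm ((cmod (\<alpha> n * coord x n))\<^sup>2) \<le> (cmod (coord x n))\<^sup>2 * K\<^sup>2" for n
        using power_mono[OF le[where x = x and n = n] norm_ge_zero, of 2] by (simp add: power_mult_distrib)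
    qed
    moreover define g where "g x = Abs_ell2 (\<lambda>n. \<alpha> n * coord x n)" for x
    ultimately have co: "coord (g x) n = \<alpha> n * coord x n" for x n
      by (simp add: Abs_ell2_inverse)
    have "bounded_linear g"
    proof (rule bounded_linear_intro)
      show "norm (g x) \<le> norm x * K" for x
        by (rule norm_le_by_coords) (use le K0 in \<open>simp_all only: co\<close>)
    qed (auto intro!: ell2_eqI simp: co algebra_simps)
    moreover have "g (c *\<^sub>C x) = c *\<^sub>C g x" for c x
      by (rule ell2_eqI) (simp add: co)
    moreover have fg: "?f x = g x" for x using True by (simp add: g_def)
    ultimately show ?thesis unfolding fg by blast
  qed (simp add: scaleC_algebra)
qed

lift_definition shift_ell2 :: "ell2 \<Rightarrow> ell2" is "\<lambda>x n. case n of 0 \<Rightarrow> 0 | Suc m \<Rightarrow> x m"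
  by (subst summable_Suc_iff[symmetric]) simp

lemma coord_shift_ell2: "coord (shift_ell2 x) n = (case n of 0 \<Rightarrow> 0 | Suc m \<Rightarrow> coord x m)"
  by (simp add: shift_ell2.rep_eq)

lemma norm_shift_ell2: "norm (shift_ell2 x) = norm x"
proof -
  have "(\<lambda>n. (cmod (coord (shift_ell2 x) (Suc n)))\<^sup>2) sums (norm x)\<^sup>2"
    using norm_sq_sums[of x] by (simp add: coord_shift_ell2)
  then have "(\<lambda>n. (cmod (coord (shift_ell2 x) n))\<^sup>2) sums (norm x)\<^sup>2"
    by (subst (asm) sums_Suc_iff) (simp add: coord_shift_ell2)
  then have "(norm (shift_ell2 x))\<^sup>2 = (norm x)\<^sup>2"
    using norm_sq_sums sums_unique2 by blast
  then show ?thesis by (rule power2_eq_imp_eq) auto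
qed

lift_definition shift :: bop is shift_ell2
  by (auto intro!: bounded_linear_intro[of _ 1] ell2_eqI
      simp: coord_shift_ell2 norm_shift_ell2 split: nat.split)

lift_definition munit :: "nat \<Rightarrow> nat \<Rightarrow> bop" is "\<lambda>m n x. cinner x (ket n) *\<^sub>C ket m"
proof -
  fix m n
  show "bounded_linear (\<lambda>x. cinner x (ket n) *\<^sub>C ket m) \<and>
    (\<forall>c x. cinner (c *\<^sub>C x) (ket n) *\<^sub>C ket m = c *\<^sub>C cinner x (ket n) *\<^sub>C ket m)"
    unfolding cinner_ket_right
    by (auto intro!: bounded_linear_intro[of _ 1] ell2_eqI
        simp: norm_scaleC cmod_coord_le algebra_simps)
qed

lemma diag_op_ket: "bounded (range \<alpha>) \<Longrightarrow> app (diag_op \<alpha>) (ket n) = \<alpha> n *\<^sub>C ket n"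
proof -
  assume b: "bounded (range \<alpha>)"
  have "(\<lambda>k. \<alpha> k * coord (ket n) k) = coord (\<alpha> n *\<^sub>C ket n)" by auto
  then show ?thesis using b by (simp add: diag_op.rep_eq coord_inverse)
qed

lemma shift_ket: "app shift (ket n) = ket (Suc n)"
  by (auto intro!: ell2_eqI simp: shift.rep_eq coord_shift_ell2 split: nat.split)

definition adj :: "bop \<Rightarrow> bop"
  where "adj S = (THE R. \<forall>x y. cinner (app S x) y = cinner x (app R y))"

lemma cinner_Cauchy_Schwarz: "cmod (cinner x y) \<le> norm x * norm y"
proof (cases "cinner x y = 0")
  case False
  define c where "c = cnj (cinner x y) / cmod (cinner x y)"
  have c1: "cmod c = 1" using False by (simp add: c_def norm_divide)
  have "c * cinner x y = of_real (cmod (cinner x y))"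
    using False complex_norm_square[of "cinner x y"]
    by (simp add: c_def mult.commute[of "cnj _"] power2_eq_square nonzero_divide_eq_eq)
  then have "cmod (cinner x y) = inner (c *\<^sub>C x) y"
    by (simp add: inner_ell2_def cinner_scaleC_left)
  also have "\<dots> \<le> norm (c *\<^sub>C x) * norm y" by (rule norm_cauchy_schwarz)
  finally show ?thesis by (simp add: norm_scaleC c1)
qed simp

lemma cinner_eqI: "(\<And>x. cinner x y = cinner x z) \<Longrightarrow> y = z"
  by (metis cinner_commute cinner_ket_right ell2_eqI)

definition trunc :: "nat \<Rightarrow> (nat \<Rightarrow> complex) \<Rightarrow> ell2"
  where "trunc N f = (\<Sum>n<N. f n *\<^sub>C ket n)"

lemma coord_sum: "coord (\<Sum>n\<in>A. g n) k = (\<Sum>n\<in>A. coord (g n) k)"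
  by (induction A rule: infinite_finite_induct) auto

lemma coord_trunc: "coord (trunc N f) k = (if k < N then f k else 0)"
proof -
  have "coord (trunc N f) k = (\<Sum>n<N. if n = k then f k else 0)"
    unfolding trunc_def coord_sum by (rule sum.cong) auto
  then show ?thesis by (simp add: sum.delta)
qed

lemma norm_trunc_sq: "(norm (trunc N f))\<^sup>2 = (\<Sum>n<N. (cmod (f n))\<^sup>2)"
proof -
  have "(\<lambda>n. (cmod (coord (trunc N f) n))\<^sup>2) sums (\<Sum>n<N. (cmod (coord (trunc N f) n))\<^sup>2)"
    by (rule sums_finite) (auto simp: coord_trunc)
  then show ?thesis
    using sums_unique2[OF norm_sq_sums[of "trunc N f"]] by (simp add: coord_trunc)
qed

lemma trunc_tendsto: "(\<lambda>N. trunc N (coord x)) \<longlonglongrightarrow> x"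
proof -
  have eq: "(norm (trunc N (coord x) - x))\<^sup>2 = (norm x)\<^sup>2 - (\<Sum>n<N. (cmod (coord x n))\<^sup>2)" for N
  proof -
    have "(\<lambda>n. (cmod (coord x n))\<^sup>2 - (if n \<in> {..<N} then (cmod (coord x n))\<^sup>2 else 0))
      sums ((norm x)\<^sup>2 - (\<Sum>n<N. (cmod (coord x n))\<^sup>2))"
      by (intro sums_diff norm_sq_sums sums_If_finite_set) simp
    also have "(\<lambda>n. (cmod (coord x n))\<^sup>2 - (if n \<in> {..<N} then (cmod (coord x n))\<^sup>2 else 0)) =
      (\<lambda>n. (cmod (coord (trunc N (coord x) - x) n))\<^sup>2)"
      by (auto simp: coord_trunc)
    finally show ?thesis using norm_sq_sums sums_unique2 by blast
  qed
  have "(\<lambda>N. (norm x)\<^sup>2 - (\<Sum>n<N. (cmod (coord x n))\<^sup>2)) \<longlonglongrightarrow> (norm x)\<^sup>2 - (norm x)\<^sup>2"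
    using norm_sq_sums[of x] unfolding sums_def by (intro tendsto_diff tendsto_const)
  then have "(\<lambda>N. sqrt ((norm (trunc N (coord x) - x))\<^sup>2)) \<longlonglongrightarrow> sqrt 0"
    unfolding eq by (intro tendsto_real_sqrt) simp
  then show ?thesis by (simp add: LIM_zero_iff tendsto_norm_zero_iff)
qed

lemma app_bounded_linear: "bounded_linear (app S)" and app_scaleC: "app S (c *\<^sub>C x) = c *\<^sub>C app S x"
  using app[of S] by auto

lemma app_trunc: "app S (trunc N f) = (\<Sum>n<N. f n *\<^sub>C app S (ket n))"
  by (simp add: trunc_def linear_sum[OF bounded_linear.linear[OF app_bounded_linear]] app_scaleC)

lemma cinner_sum_left: "cinner (\<Sum>n\<in>A. g n) y = (\<Sum>n\<in>A. cinner (g n) y)"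
  by (induction A rule: infinite_finite_induct) (auto simp: cinner_add_left, simp_all add: cinner_def)

lemma bounded_linear_cinner_left: "bounded_linear (\<lambda>x. cinner x y)"
  by (rule bounded_linear_intro[of _ "norm y"])
    (simp_all add: cinner_add_left cinner_Cauchy_Schwarz
      flip: scaleC_of_real, simp add: cinner_scaleC_left scaleR_conv_of_real)

lemma adj_ex: "\<exists>R. \<forall>x y. cinner (app S x) y = cinner x (app R y)"
proof -
  obtain K where K0: "0 \<le> K" and K: "\<And>x. norm (app S x) \<le> norm x * K"
    using bounded_linear.nonneg_bounded[OF app_bounded_linear[of S]] by blast
  define z where "z y n = cnj (cinner (app S (ket n)) y)" for y n
  have part: "(\<Sum>n<N. (cmod (z y n))\<^sup>2) \<le> (norm y * K)\<^sup>2" for y N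
  proof -
    define A where "A = (\<Sum>n<N. (cmod (z y n))\<^sup>2)"
    have A0: "0 \<le> A" unfolding A_def by (rule sum_nonneg) simp
    have nv: "norm (trunc N (z y)) = sqrt A"
      using norm_trunc_sq[of N "z y"] by (metis A_def norm_ge_zero real_sqrt_unique)
    have "cinner (app S (trunc N (z y))) y = (\<Sum>n<N. z y n * cnj (z y n))"
      by (simp add: app_trunc cinner_sum_left cinner_scaleC_left z_def)
    also have "\<dots> = of_real A"
      by (simp add: A_def complex_norm_square del: of_real_power)
    finally have "A = cmod (cinner (app S (trunc N (z y))) y)" using A0 by simp
    also have "\<dots> \<le> norm (app S (trunc N (z y))) * norm y" by (rule cinner_Cauchy_Schwarz)
    also have "\<dots> \<le> (sqrt A * K) * norm y"
      using K[of "trunc N (z y)"] by (intro mult_right_mono) (auto simp: nv)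
    finally have le: "sqrt A * sqrt A \<le> sqrt A * (norm y * K)" using A0 by (simp add: ac_simps)
    have "sqrt A \<le> norm y * K"
    proof (cases "A = 0")
      case False
      then have "0 < sqrt A" using A0 by simp
      then show ?thesis using le by (rule mult_left_le_imp_le[rotated])
    qed (use K0 in simp)
    then have "(sqrt A)\<^sup>2 \<le> (norm y * K)\<^sup>2" by (rule power_mono) (use A0 in simp)
    then show ?thesis using A0 by (simp add: A_def)
  qed
  have summ: "summable (\<lambda>n. (cmod (z y n))\<^sup>2)" for y
    by (rule summableI_nonneg_bounded[OF _ part]) simp
  define R where "R y = Abs_ell2 (z y)" for y
  have coR: "coord (R y) n = z y n" for y n
    using summ[of y] by (simp add: R_def Abs_ell2_inverse)
  have normR: "norm (R y) \<le> norm y * K" for y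
  proof -
    have "(norm (R y))\<^sup>2 \<le> (norm y * K)\<^sup>2"
      using suminf_le_const[OF summ part[of y]] sums_unique[OF norm_sq_sums[of "R y"]]
      by (simp add: coR)
    then show ?thesis by (rule power2_le_imp_le) (use K0 in simp)
  qed
  have z_alt: "z y n = cinner y (app S (ket n))" for y n
    unfolding z_def by (rule cinner_commute[symmetric])
  have z_add: "z (x + y) n = z x n + z y n" and z_scale: "z (c *\<^sub>C x) n = c * z x n" for x y n c
    by (simp_all add: z_alt cinner_add_left cinner_scaleC_left)
  have bl: "bounded_linear R"
    by (rule bounded_linear_intro[OF _ _ normR])
      (auto intro!: ell2_eqI simp: coR z_add z_scale simp flip: scaleC_of_real)
  have sc: "R (c *\<^sub>C x) = c *\<^sub>C R x" for c x
    by (rule ell2_eqI) (simp add: coR z_scale)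
  have appR: "app (Abs_bop R) = R" by (rule Abs_bop_inverse) (simp add: bl sc)
  have "cinner (app S x) y = cinner x (R y)" for x y
  proof -
    have "(\<lambda>N. cinner (app S (trunc N (coord x))) y) \<longlonglongrightarrow> cinner (app S x) y"
      by (intro bounded_linear.tendsto[OF bounded_linear_cinner_left]
          bounded_linear.tendsto[OF app_bounded_linear] trunc_tendsto)
    moreover have "(\<lambda>N. cinner (app S (trunc N (coord x))) y) =
        (\<lambda>N. \<Sum>n<N. coord x n * cnj (coord (R y) n))"
      by (simp add: app_trunc cinner_sum_left cinner_scaleC_left coR z_def)
    ultimately show ?thesis
      using cinner_sums[of x "R y"] unfolding sums_def by (auto dest: LIMSEQ_unique)
  qed
  then show ?thesis by (intro exI[of _ "Abs_bop R"]) (simp add: appR)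
qed

lemma cinner_adj: "cinner (app S x) y = cinner x (app (adj S) y)"
proof -
  have "\<exists>!R. \<forall>x y. cinner (app S x) y = cinner x (app R y)"
  proof (rule ex_ex1I[OF adj_ex])
    fix R R' assume "\<forall>x y. cinner (app S x) y = cinner x (app R y)"
      and "\<forall>x y. cinner (app S x) y = cinner x (app R' y)"
    then show "R = R'" by (intro bop_eqI cinner_eqI) metis
  qed
  from theI'[OF this] show ?thesis unfolding adj_def by blast
qed

section \<open>Trace class operators and normal states\<close>

definition pos_op :: "bop \<Rightarrow> bool"
  where "pos_op S \<longleftrightarrow> (\<forall>x. cinner (app S x) x \<in> \<real>\<^sub>\<ge>\<^sub>0)"

text \<open>The witness \<open>R\<close> is the absolute value of \<open>S\<close>, that is, the (unique) positive square root
  of the product of the adjoint of \<open>S\<close> with \<open>S\<close>.\<close>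

definition trace_class :: "bop \<Rightarrow> bool"
  where "trace_class S \<longleftrightarrow>
    (\<exists>R. pos_op R \<and> R * R = adj S * S \<and> summable (\<lambda>n. cinner (app R (ket n)) (ket n)))"

definition op_trace :: "bop \<Rightarrow> complex"
  where "op_trace S = (\<Sum>n. cinner (app S (ket n)) (ket n))"

definition is_state :: "(bop \<Rightarrow> complex) \<Rightarrow> bool"
  where "is_state \<phi> \<longleftrightarrow>
    (\<forall>x y. \<phi> (x + y) = \<phi> x + \<phi> y) \<and> (\<forall>c x. \<phi> (c *\<^sub>O x) = c * \<phi> x) \<and>
    (\<forall>x. \<phi> (adj x * x) \<in> \<real>\<^sub>\<ge>\<^sub>0) \<and> \<phi> 1 = 1"

definition normal_state :: "(bop \<Rightarrow> complex) \<Rightarrow> bool"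
  where "normal_state \<phi> \<longleftrightarrow>
    is_state \<phi> \<and> (\<exists>\<sigma>. trace_class \<sigma> \<and> (\<forall>x. \<phi> x = op_trace (\<sigma> * x)))"

definition invariant_under :: "(bop \<Rightarrow> bop) \<Rightarrow> (bop \<Rightarrow> complex) \<Rightarrow> bool"
  where "invariant_under T \<phi> \<longleftrightarrow> \<phi> \<circ> T = \<phi>"

section \<open>States on $M_2(\mathbb C)$ and their parameters\<close>

text \<open>The ring multiplication on \<open>complex^2^2\<close> is componentwise; the matrix product is \<open>**\<close>, and
  \<open>mat c ** y\<close> is the scalar multiple \<open>c y\<close>.\<close>

definition cadj :: "complex^2^2 \<Rightarrow> complex^2^2"
  where "cadj y = (\<chi> i j. cnj (y $ j $ i))"

definition munit2 :: "2 \<Rightarrow> 2 \<Rightarrow> complex^2^2"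
  where "munit2 i j = (\<chi> k l. if k = i \<and> l = j then 1 else 0)"

definition is_state2 :: "(complex^2^2 \<Rightarrow> complex) \<Rightarrow> bool"
  where "is_state2 \<psi> \<longleftrightarrow>
    (\<forall>x y. \<psi> (x + y) = \<psi> x + \<psi> y) \<and> (\<forall>c y. \<psi> (mat c ** y) = c * \<psi> y) \<and>
    (\<forall>y. \<psi> (cadj y ** y) \<in> \<real>\<^sub>\<ge>\<^sub>0) \<and> \<psi> (mat 1) = 1"

definition rho :: "real \<Rightarrow> complex \<Rightarrow> complex^2^2"
  where "rho l \<zeta> = vector
    [vector [of_real l, cnj \<zeta> * of_real (sqrt (l * (1 - l)))],
     vector [\<zeta> * of_real (sqrt (l * (1 - l))), of_real (1 - l)]]"

definition has_parameters :: "(complex^2^2 \<Rightarrow> complex) \<Rightarrow> real \<Rightarrow> complex \<Rightarrow> bool"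
  where "has_parameters \<psi> l \<zeta> \<longleftrightarrow>
    0 \<le> l \<and> l \<le> 1 \<and> cmod \<zeta> \<le> 1 \<and> (l = 0 \<or> l = 1 \<longrightarrow> \<zeta> = 0) \<and>
    (\<forall>y. \<psi> y = trace (rho l \<zeta> ** y))"

lemma is_state2_has_parameters:
  assumes "is_state2 \<psi>"
  shows "\<exists>l \<zeta>. has_parameters \<psi> l \<zeta>"
proof -
  have add: "\<psi> (a + b) = \<psi> a + \<psi> b" and scale: "\<psi> (mat c ** a) = c * \<psi> a"
    and pos: "\<psi> (cadj a ** a) \<in> \<real>\<^sub>\<ge>\<^sub>0" and one: "\<psi> (mat 1) = 1" for a b c
    using assms by (auto simp: is_state2_def)
  define p q r t where "p = \<psi> (munit2 1 1)" and "q = \<psi> (munit2 1 2)"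
    and "r = \<psi> (munit2 2 1)" and "t = \<psi> (munit2 2 2)"
  have expand: "\<psi> y = y $ 1 $ 1 * p + y $ 1 $ 2 * q + y $ 2 $ 1 * r + y $ 2 $ 2 * t" for y
  proof -
    have "y = mat (y $ 1 $ 1) ** munit2 1 1 + mat (y $ 1 $ 2) ** munit2 1 2 +
        mat (y $ 2 $ 1) ** munit2 2 1 + mat (y $ 2 $ 2) ** munit2 2 2"
      by (simp add: sum_2 vec_eq_iff forall_2 munit2_def mat_def matrix_matrix_mult_def)
    then have "\<psi> y = \<psi> \<dots>" by (rule arg_cong)
    then show ?thesis by (simp add: add scale p_def q_def r_def t_def)
  qed
  have form: "cnj a * a * p + cnj a * b * q + cnj b * a * r + cnj b * b * t \<in> \<real>\<^sub>\<ge>\<^sub>0" for a b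
    using pos[of "vector [vector [a, b], vector [0, 0]]"]
    by (simp add: expand cadj_def matrix_matrix_mult_def sum_2)
  have nonneg: "z \<in> \<real>\<^sub>\<ge>\<^sub>0 \<longleftrightarrow> Im z = 0 \<and> 0 \<le> Re z" for z
    by (auto simp: complex_nonneg_Reals_iff)
  have p0: "Im p = 0" "0 \<le> Re p" using form[of 1 0] by (auto simp: nonneg)
  have t0: "Im t = 0" "0 \<le> Re t" using form[of 0 1] by (auto simp: nonneg)
  have pt: "p + t = 1" using one by (simp add: expand mat_def)
  then have Ret: "Re t = 1 - Re p" by (simp add: complex_eq_iff)
  have "Re r = Re q" "Im r = - Im q"
    using form[of 1 \<i>] form[of 1 1] p0 t0 by (auto simp: nonneg)
  then have r: "r = cnj q" by (simp add: complex_eq_iff)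
  have cq: "(cmod q)\<^sup>2 = Re q * Re q + Im q * Im q"
    using cmod_power2[of q] by (simp only: power2_eq_square)
  have "0 \<le> Re p * (Re p * Re t - (cmod q)\<^sup>2)"
    using form[of "- q" p] p0 t0 by (simp add: nonneg r cq algebra_simps)
  moreover have "0 \<le> Re t * (Re p * Re t - (cmod q)\<^sup>2)"
    using form[of t "- cnj q"] p0 t0 by (simp add: nonneg r cq algebra_simps)
  ultimately have "0 \<le> (Re p + Re t) * (Re p * Re t - (cmod q)\<^sup>2)" by (simp add: distrib_right)
  then have q_le: "(cmod q)\<^sup>2 \<le> Re p * (1 - Re p)" by (simp add: Ret)
  define l where "l = Re p"
  define w where "w = sqrt (l * (1 - l))"
  define \<zeta> where "\<zeta> = q / of_real w"
  have l01: "0 \<le> l" "l \<le> 1" using p0 t0 Ret by (auto simp: l_def)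
  have w0: "0 \<le> w" using l01 by (simp add: w_def)
  have "cmod q \<le> w" unfolding w_def by (rule real_le_rsqrt) (use q_le in \<open>simp add: l_def\<close>)
  then have qw: "q = \<zeta> * of_real w" and z1: "cmod \<zeta> \<le> 1"
    using w0 by (auto simp: \<zeta>_def norm_divide divide_le_eq)
  have pl: "p = of_real l" and tl: "t = of_real (1 - l)"
    using p0 t0 Ret by (auto simp: l_def complex_eq_iff)
  have "\<psi> y = trace (rho l \<zeta> ** y)" for y
    unfolding expand rho_def w_def[symmetric]
    by (simp add: trace_def matrix_matrix_mult_def sum_2 pl tl r qw algebra_simps)
  moreover have "l = 0 \<or> l = 1 \<longrightarrow> \<zeta> = 0" by (auto simp: \<zeta>_def w_def)
  ultimately show ?thesis using l01 z1 unfolding has_parameters_def by blast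
qed

section \<open>The transition operator\<close>

text \<open>Operators on the tensor product of \<open>ell2\<close> with the two-dimensional space are represented
  by \<open>2 \<times> 2\<close> matrices of operators on \<open>ell2\<close>.\<close>

definition tensor :: "bop \<Rightarrow> complex^2^2 \<Rightarrow> bop^2^2"
  where "tensor x y = (\<chi> i j. y $ i $ j *\<^sub>O x)"

definition madj :: "bop^2^2 \<Rightarrow> bop^2^2"
  where "madj X = (\<chi> i j. adj (X $ j $ i))"

definition u_op :: "(nat \<Rightarrow> complex) \<Rightarrow> (nat \<Rightarrow> complex) \<Rightarrow> bop^2^2"
  where "u_op \<alpha> \<beta> = (let a = diag_op \<alpha>; b = diag_op \<beta>; s = shift in vector
    [vector [adj s * a * s, \<i> *\<^sub>O (adj s * b)],
     vector [\<i> *\<^sub>O (b * s), a]])"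

definition P_map :: "(complex^2^2 \<Rightarrow> complex) \<Rightarrow> bop^2^2 \<Rightarrow> bop"
  where "P_map \<psi> X = (\<Sum>i\<in>UNIV. \<Sum>j\<in>UNIV. \<psi> (munit2 i j) *\<^sub>O (X $ i $ j))"

definition transition :: "(nat \<Rightarrow> complex) \<Rightarrow> (nat \<Rightarrow> complex) \<Rightarrow> (complex^2^2 \<Rightarrow> complex) \<Rightarrow> bop \<Rightarrow> bop"
  where "transition \<alpha> \<beta> \<psi> x = P_map \<psi> (madj (u_op \<alpha> \<beta>) ** tensor x (mat 1) ** u_op \<alpha> \<beta>)"

lemma scaleC_op_algebra:
  "c *\<^sub>O (x + y) = c *\<^sub>O x + c *\<^sub>O y" "(c + d) *\<^sub>O x = c *\<^sub>O x + d *\<^sub>O x" "c *\<^sub>O d *\<^sub>O x = (c * d) *\<^sub>O x"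
  by (transfer; simp add: scaleC_algebra fun_eq_iff)+

text \<open>\<open>P_map \<psi>\<close> is the linear extension of \<open>tensor x y \<mapsto> \<psi> y x\<close>.\<close>

lemma P_map_tensor:
  assumes "is_state2 \<psi>"
  shows "P_map \<psi> (tensor x y) = \<psi> y *\<^sub>O x"
proof -
  have add: "\<psi> (a + b) = \<psi> a + \<psi> b" and scale: "\<psi> (mat c ** a) = c * \<psi> a" for a b c
    using assms by (auto simp: is_state2_def)
  have "y = (\<Sum>i\<in>UNIV. \<Sum>j\<in>UNIV. mat (y $ i $ j) ** munit2 i j)"
    by (simp add: sum_2 vec_eq_iff forall_2 munit2_def mat_def matrix_matrix_mult_def)
  then have "\<psi> y = \<psi> (\<Sum>i\<in>UNIV. \<Sum>j\<in>UNIV. mat (y $ i $ j) ** munit2 i j)" by simp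
  also have "\<dots> = (\<Sum>i\<in>UNIV. \<Sum>j\<in>UNIV. y $ i $ j * \<psi> (munit2 i j))"
    by (simp add: sum_2 add scale)
  finally show ?thesis
    by (simp add: P_map_def tensor_def sum_2 scaleC_op_algebra mult.commute add.assoc)
qed

lemma P_map_add: "P_map \<psi> (X + Y) = P_map \<psi> X + P_map \<psi> Y"
  by (simp add: P_map_def scaleC_op_algebra sum.distrib)

lemma P_map_scale: "P_map \<psi> (\<chi> i j. c *\<^sub>O (X $ i $ j)) = c *\<^sub>O P_map \<psi> X"
  by (simp add: P_map_def sum_2 scaleC_op_algebra mult.commute)

end

theory Submission
  imports Defs
begin

text \<open>
  For these coefficients \<open>a\<close> is the projection \<open>p\<close> onto the ground vector \<open>ket 0\<close> and
  \<open>b = 1 - p\<close>, so that \<open>u\<close> exchanges excitations completely, and the transition operator becomes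
  \<open>T x = l s\<^sup>* x s + (1 - l) (s x s\<^sup>* + p x p) - i \<zeta> w s\<^sup>* x p + i \<zeta>' w p x s\<close>,
  where \<open>w = sqrt (l (1 - l))\<close> and \<open>\<zeta>'\<close> is the conjugate of \<open>\<zeta>\<close>: a random walk on the number of
  excitations with steps up and down of weights \<open>l\<close> and \<open>1 - l\<close>, together with a coherent drive
  that acts at the boundary \<open>0\<close> only.

  Necessity and uniqueness. Along a diagonal, \<open>g n = \<phi> (munit n (n + k))\<close> satisfies the
  recursion \<open>g (n + 1) = l g n + (1 - l) g (n + 2)\<close>, which says that the current
  \<open>(1 - l) g (n + 1) - l g n\<close> is constant. The diagonal of a normal state is summable and
  dominates the other matrix elements by positivity, so the current vanishes
  (\<open>invariant_matrix_step\<close>). Summed over the main diagonal this gives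
  \<open>(1 - l) \<phi> (munit 0 0) = 1 - 2 l\<close> (\<open>invariant_ground_weight\<close>). Positivity then forces
  \<open>l \<le> 1 / 2\<close>, and at \<open>l = 1 / 2\<close> the diagonal would be identically zero. For \<open>l < 1 / 2\<close> every
  diagonal is geometric with ratio \<open>r = l / (1 - l)\<close>, and the boundary drive fixes the initial
  values: \<open>\<phi> (munit 0 (k + 1)) = c \<phi> (munit 0 k)\<close> for \<open>c = i \<zeta>' sqrt r\<close>.

  Existence. Instead of verifying that the resulting matrix is a positive trace class operator,
  the state is written as a mixture of vector states, for which positivity and normality are
  automatic (\<open>normal_state_mixture\<close>). Let \<open>v\<close> be the vector with coordinates \<open>c ^ n\<close> and let
  \<open>\<omega> j\<close> be the functional \<open>x \<mapsto> cinner (x (s ^ j v)) (s ^ j v)\<close>. On the diagonal of distance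
  \<open>k\<close> it contributes \<open>c ^ k\<close> times \<open>\<bar>c\<bar>\<^sup>2 ^ (n - j)\<close> for \<open>j \<le> n\<close>. The weights \<open>1\<close> for \<open>j = 0\<close> and
  \<open>(r - \<bar>c\<bar>\<^sup>2) r ^ (j - 1)\<close> for \<open>j > 0\<close> make these contributions telescope to \<open>c ^ k r ^ n\<close>, and
  the factor \<open>1 - r\<close> normalizes the sum; they are nonnegative because
  \<open>\<bar>c\<bar>\<^sup>2 = \<bar>\<zeta>\<bar>\<^sup>2 r \<le> r\<close>. Because \<open>s\<^sup>* v = c v\<close> and
  \<open>v = ket 0 + c s v\<close>, composition with the transition operator maps the span of the \<open>\<omega> j\<close> into itself, and
  invariance is an identity between geometric series.
\<close>

section \<open>Operators determined by their sesquilinear forms\<close>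

lemma cinner_add_right: "cinner x (y + z) = cinner x y + cinner x z"
  by (subst (1 2 3) cinner_commute) (simp add: cinner_add_left)

lemma cinner_scaleC_right: "cinner x (c *\<^sub>C y) = cnj c * cinner x y"
  by (subst (1 2) cinner_commute) (simp add: cinner_scaleC_left)

lemma cinner_zero [simp]: "cinner 0 y = 0" "cinner x 0 = 0"
  by (simp_all add: cinner_def)

lemma cinner_ket_left: "cinner (ket n) y = cnj (coord y n)"
  by (subst cinner_commute) (simp add: cinner_ket_right)

lemma cinner_self: "cinner x x = of_real ((norm x)\<^sup>2)"
proof -
  have "Im (cinner x x) = 0"
    using cinner_commute[of x x] by (simp add: complex_eq_iff)
  then show ?thesis
    using sums_unique2[OF cinner_self_sums[of x] norm_sq_sums[of x]] by (simp add: complex_eq_iff)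
qed

lemmas cinner_linear = cinner_add_left cinner_add_right cinner_scaleC_left cinner_scaleC_right

lemma app_simps [simp]:
  "app 0 x = 0" "app 1 x = x" "app (S + R) x = app S x + app R x" "app (- S) x = - app S x"
  "app (S - R) x = app S x - app R x" "app (S * R) x = app S (app R x)"
  "app (c *\<^sub>O S) x = c *\<^sub>C app S x" "app (munit m n) x = coord x n *\<^sub>C ket m"
  by (simp_all add: zero_bop.rep_eq one_bop.rep_eq plus_bop.rep_eq uminus_bop.rep_eq
      minus_bop.rep_eq times_bop.rep_eq scaleC_op.rep_eq munit.rep_eq cinner_ket_right)

lemma app_add: "app S (x + y) = app S x + app S y"
  using app_bounded_linear by (simp add: linear_simps)

lemma app_sum: "app (\<Sum>i\<in>A. S i) x = (\<Sum>i\<in>A. app (S i) x)"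
  by (induction A rule: infinite_finite_induct) simp_all

lemma bop_eqI_form:
  assumes "\<And>x y. cinner (app S x) y = cinner (app R x) y"
  shows "S = R"
  by (intro bop_eqI ell2_eqI) (metis assms cinner_ket_right)

lemma adj_eqI:
  assumes "\<And>x y. cinner (app S x) y = cinner x (app R y)"
  shows "adj S = R"
  by (intro bop_eqI cinner_eqI) (metis assms cinner_adj)

lemma cinner_adj_left: "cinner (app (adj S) x) y = cinner x (app S y)"
  by (metis cinner_adj cinner_commute)

lemma norm_app_bounded:
  obtains K where "0 \<le> K" "\<And>x. norm (app S x) \<le> norm x * K"
  using bounded_linear.nonneg_bounded[OF app_bounded_linear[of S]] by blast

lemma zero_scaleC_op [simp]: "0 *\<^sub>O S = 0"
  by (rule bop_eqI) (auto intro: ell2_eqI)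

section \<open>Mixtures of vector states\<close>

text \<open>The frame operator \<open>W\<^sup>* W\<close> of the analysis operator \<open>W\<close> obtained here has the form
  \<open>(x, y) \<mapsto> (\<Sum>j. cinner x (v j) * cnj (cinner y (v j)))\<close>, so it is the density matrix of the
  mixture of the vector states of the \<open>v j\<close>, and its positivity comes for free.\<close>

lemma analysis_operator_exists:
  assumes "summable (\<lambda>j. (norm (v j))\<^sup>2)"
  shows "\<exists>W. \<forall>y j. coord (app W y) j = cinner y (v j)"
proof -
  define B where "B = (\<Sum>j. (norm (v j))\<^sup>2)"
  have B0: "0 \<le> B" unfolding B_def by (rule suminf_nonneg[OF assms]) simp
  have le: "(cmod (cinner y (v j)))\<^sup>2 \<le> (norm y)\<^sup>2 * (norm (v j))\<^sup>2" for y j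
    using power_mono[OF cinner_Cauchy_Schwarz[of y "v j"] norm_ge_zero, of 2]
    by (simp add: power_mult_distrib)
  have summ: "summable (\<lambda>j. (cmod (cinner y (v j)))\<^sup>2)" for y
    by (rule summable_comparison_test'[OF summable_mult[OF assms, of "(norm y)\<^sup>2"]]) (simp add: le)
  define w where "w y = Abs_ell2 (\<lambda>j. cinner y (v j))" for y
  have co: "coord (w y) j = cinner y (v j)" for y j
    using summ[of y] by (simp add: w_def Abs_ell2_inverse)
  have bound: "norm (w y) \<le> norm y * sqrt B" for y
  proof -
    have "(norm (w y))\<^sup>2 = (\<Sum>j. (cmod (cinner y (v j)))\<^sup>2)"
      using sums_unique[OF norm_sq_sums[of "w y"]] by (simp add: co)
    also have "\<dots> \<le> (\<Sum>j. (norm y)\<^sup>2 * (norm (v j))\<^sup>2)"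
      by (rule suminf_le[OF le summ summable_mult[OF assms]])
    also have "\<dots> = (norm y * sqrt B)\<^sup>2"
      using B0 by (simp add: suminf_mult[OF assms] B_def power_mult_distrib)
    finally show ?thesis by (rule power2_le_imp_le) (simp add: B0)
  qed
  have "bounded_linear w"
    by (rule bounded_linear_intro[OF _ _ bound])
      (auto intro!: ell2_eqI simp: co cinner_linear simp flip: scaleC_of_real)
  moreover have "w (c *\<^sub>C x) = c *\<^sub>C w x" for c x
    by (rule ell2_eqI) (simp add: co cinner_linear)
  ultimately have "app (Abs_bop w) = w" by (intro Abs_bop_inverse) simp
  then show ?thesis by (intro exI[of _ "Abs_bop w"]) (simp add: co)
qed

text \<open>Both iterated sums of \<open>cinner (app x (ket n)) (v j) * cnj (cinner (ket n) (v j))\<close> agree: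
  summing over \<open>n\<close> first is Parseval's identity for \<open>v j\<close>, summing over \<open>j\<close> first gives the diagonal
  of the density matrix times \<open>x\<close>. The exchange is legitimate because the summand is dominated by
  a sum of two squares, and the sums of these squares over \<open>n\<close> are the squared norms of \<open>v j\<close> and
  \<open>app (adj x) (v j)\<close>, which are summable over \<open>j\<close>.\<close>

lemma frame_trace:
  assumes v: "summable (\<lambda>j. (norm (v j))\<^sup>2)"
    and W: "\<And>y j. coord (app W y) j = cinner y (v j)"
  shows "\<exists>t. (\<lambda>n. cinner (app (adj W * W * x) (ket n)) (ket n)) sums t \<and>
    (\<lambda>j. cinner (app x (v j)) (v j)) sums t"
proof -
  define f where "f j n = coord (v j) n * cnj (coord (app (adj x) (v j)) n)" for j n
  have f_alt: "f j n = cinner (app x (ket n)) (v j) * cnj (cinner (ket n) (v j))" for j n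
    by (simp add: f_def cinner_ket_left cinner_adj mult.commute)
  obtain K where K0: "0 \<le> K" and K: "\<And>y. norm (app (adj x) y) \<le> norm y * K"
    using norm_app_bounded by blast
  define g where "g j n = (cmod (coord (v j) n))\<^sup>2 + (cmod (coord (app (adj x) (v j)) n))\<^sup>2" for j n
  have g0: "0 \<le> g j n" for j n by (simp add: g_def)
  have g_row: "(g j has_sum ((norm (v j))\<^sup>2 + (norm (app (adj x) (v j)))\<^sup>2)) UNIV" for j
    unfolding g_def by (rule sums_nonneg_imp_has_sum) (auto intro!: sums_add norm_sq_sums)
  have rows: "summable (\<lambda>j. (norm (v j))\<^sup>2 + (norm (app (adj x) (v j)))\<^sup>2)"
  proof (rule summable_comparison_test'[OF summable_mult2[OF v, of "1 + K\<^sup>2"]])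
    fix j
    show "norm ((norm (v j))\<^sup>2 + (norm (app (adj x) (v j)))\<^sup>2) \<le> (norm (v j))\<^sup>2 * (1 + K\<^sup>2)"
      using power_mono[OF K[of "v j"] norm_ge_zero, of 2]
      by (simp add: power_mult_distrib algebra_simps)
  qed
  have row_sum: "infsum (\<lambda>n. \<bar>g j n\<bar>) UNIV = (norm (v j))\<^sup>2 + (norm (app (adj x) (v j)))\<^sup>2" for j
    using infsumI[OF g_row[of j]] g0 by simp
  have "(\<lambda>p. norm (case p of (j, n) \<Rightarrow> g j n)) summable_on UNIV \<times> UNIV"
    unfolding Infinite_Sum.abs_summable_on_Sigma_iff
  proof (intro conjI ballI)
    show "(\<lambda>n. norm (case (j, n) of (j, n) \<Rightarrow> g j n)) summable_on UNIV" for j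
      using g_row[of j] g0 by (auto simp: summable_on_def)
    show "(\<lambda>j. norm (\<Sum>\<^sub>\<infinity>n. norm (case (j, n) of (j, n) \<Rightarrow> g j n))) summable_on UNIV"
      using sums_nonneg_imp_has_sum[OF summable_sums[OF rows]] by (simp add: row_sum has_sum_imp_summable)
  qed
  then have "(\<lambda>p. norm (case p of (j, n) \<Rightarrow> f j n)) summable_on UNIV \<times> UNIV"
  proof (rule Infinite_Sum.abs_summable_on_comparison_test)
    fix p :: "nat \<times> nat"
    show "norm (case p of (j, n) \<Rightarrow> f j n) \<le> norm (case p of (j, n) \<Rightarrow> g j n)"
    proof (cases p)
      case (Pair j n)
      have "0 \<le> cmod (coord (v j) n) * cmod (coord (app (adj x) (v j)) n)" by simp
      then show ?thesis
        using sum_squares_bound[of "cmod (coord (v j) n)" "cmod (coord (app (adj x) (v j)) n)"]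
        by (simp add: Pair f_def g_def norm_mult del: mult_nonneg_nonneg)
    qed
  qed
  then obtain t where t: "((\<lambda>(j, n). f j n) has_sum t) (UNIV \<times> UNIV)"
    using Infinite_Sum.abs_summable_summable summable_on_def by blast
  have row: "(f j has_sum cinner (app x (v j)) (v j)) UNIV" for j
  proof (rule norm_summable_imp_has_sum)
    show "summable (\<lambda>n. norm (f j n))"
      unfolding f_def by (rule summable_sq_prod[OF coord_sq_summable coord_sq_summable])
    show "f j sums cinner (app x (v j)) (v j)"
      unfolding f_def cinner_adj by (rule cinner_sums)
  qed
  have col: "((\<lambda>j. f j n) has_sum cinner (app (adj W * W * x) (ket n)) (ket n)) UNIV" for n
  proof (rule norm_summable_imp_has_sum)
    have eq: "f j n = coord (app W (app x (ket n))) j * cnj (coord (app W (ket n)) j)" for j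
      by (simp add: W f_alt)
    show "summable (\<lambda>j. norm (f j n))"
      unfolding eq by (rule summable_sq_prod[OF coord_sq_summable coord_sq_summable])
    show "(\<lambda>j. f j n) sums cinner (app (adj W * W * x) (ket n)) (ket n)"
      unfolding eq by (simp add: cinner_adj_left cinner_sums)
  qed
  have "((\<lambda>j. cinner (app x (v j)) (v j)) has_sum t) UNIV"
    by (rule has_sum_SigmaD[OF t]) (simp add: row)
  moreover have "((\<lambda>n. cinner (app (adj W * W * x) (ket n)) (ket n)) has_sum t) UNIV"
    by (rule has_sum_SigmaD[OF t[THEN has_sum_swap[THEN iffD1]]]) (use col in simp)
  ultimately show ?thesis using has_sum_imp_sums by blast
qed

text \<open>\<open>W\<^sup>* W\<close> is positive, hence its own absolute value.\<close>

lemma trace_class_frame: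
  assumes v: "summable (\<lambda>j. (norm (v j))\<^sup>2)"
    and W: "\<And>y j. coord (app W y) j = cinner y (v j)"
  shows "trace_class (adj W * W)"
  unfolding trace_class_def
proof (intro exI conjI)
  show "pos_op (adj W * W)"
    by (simp add: pos_op_def cinner_adj_left cinner_self)
  have "adj (adj W * W) = adj W * W"
    by (rule adj_eqI) (simp add: cinner_adj_left, simp add: cinner_adj)
  then show "(adj W * W) * (adj W * W) = adj (adj W * W) * (adj W * W)" by simp
  show "summable (\<lambda>n. cinner (app (adj W * W) (ket n)) (ket n))"
    using frame_trace[OF v W, of 1] by (auto simp: sums_iff)
qed

text \<open>The vectors need not be orthogonal or of norm one: their squared norms are the weights.\<close>

lemma normal_state_mixture:
  assumes v: "(\<lambda>j. (norm (v j))\<^sup>2) sums 1"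
    and \<phi>: "\<And>x. (\<lambda>j. cinner (app x (v j)) (v j)) sums \<phi> x"
  shows "normal_state \<phi>"
proof -
  have v': "summable (\<lambda>j. (norm (v j))\<^sup>2)" using v by (simp add: sums_iff)
  obtain W where W: "\<And>y j. coord (app W y) j = cinner y (v j)"
    using analysis_operator_exists[OF v'] by blast
  have "\<phi> x = op_trace ((adj W * W) * x)" for x
    using frame_trace[OF v' W, of x] \<phi>[of x] unfolding op_trace_def
    by (metis sums_unique sums_unique2)
  moreover have "is_state \<phi>"
    unfolding is_state_def
  proof (intro conjI allI)
    show "\<phi> (x + y) = \<phi> x + \<phi> y" for x y
      by (rule sums_unique2[OF \<phi>]) (use sums_add[OF \<phi>[of x] \<phi>[of y]] in \<open>simp add: cinner_linear\<close>)
    show "\<phi> (c *\<^sub>O x) = c * \<phi> x" for c x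
      by (rule sums_unique2[OF \<phi>]) (use sums_mult[OF \<phi>[of x], of c] in \<open>simp add: cinner_linear\<close>)
    show "\<phi> 1 = 1"
      by (rule sums_unique2[OF \<phi>]) (use sums_of_real[OF v] in \<open>simp add: cinner_self\<close>)
    fix x
    have "(\<lambda>j. of_real ((norm (app x (v j)))\<^sup>2)) sums \<phi> (adj x * x)"
      using \<phi>[of "adj x * x"] by (simp add: cinner_adj_left cinner_self)
    then have Re: "(\<lambda>j. (norm (app x (v j)))\<^sup>2) sums Re (\<phi> (adj x * x))"
      and Im: "(\<lambda>j. 0) sums Im (\<phi> (adj x * x))"
      by (auto dest: sums_Re sums_Im)
    have "0 \<le> Re (\<phi> (adj x * x))" by (rule sums_le[OF _ sums_zero Re]) simp
    moreover have "Im (\<phi> (adj x * x)) = 0" using sums_unique2[OF Im sums_zero] .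
    ultimately show "\<phi> (adj x * x) \<in> \<real>\<^sub>\<ge>\<^sub>0" by (simp add: complex_nonneg_Reals_iff)
  qed
  ultimately show ?thesis
    unfolding normal_state_def using trace_class_frame[OF v' W] by blast
qed


section \<open>Matrix elements of a normal state\<close>

lemma adj_munit: "adj (munit m n) = munit n m"
  by (rule adj_eqI) (simp add: cinner_linear cinner_ket_left cinner_ket_right mult.commute)

text \<open>Evaluating the state on \<open>x\<^sup>* x\<close> for \<open>x = a e\<^sub>0\<^sub>m + b e\<^sub>0\<^sub>n\<close>.\<close>

lemma state_positive_form:
  assumes "is_state \<phi>"
  shows "cnj a * a * \<phi> (munit m m) + cnj a * b * \<phi> (munit m n) +
    cnj b * a * \<phi> (munit n m) + cnj b * b * \<phi> (munit n n) \<in> \<real>\<^sub>\<ge>\<^sub>0"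
proof -
  define x where "x = a *\<^sub>O munit 0 m + b *\<^sub>O munit 0 n"
  have "adj x * x = (cnj a * a) *\<^sub>O munit m m + (cnj a * b) *\<^sub>O munit m n +
    (cnj b * a) *\<^sub>O munit n m + (cnj b * b) *\<^sub>O munit n n"
    by (rule bop_eqI_form)
      (simp add: cinner_adj_left x_def cinner_linear cinner_ket_left algebra_simps)
  moreover have "\<phi> (adj x * x) \<in> \<real>\<^sub>\<ge>\<^sub>0" using assms by (simp add: is_state_def)
  ultimately show ?thesis using assms by (simp add: is_state_def)
qed

lemma state_diag_nonneg:
  assumes "is_state \<phi>"
  shows "\<phi> (munit n n) \<in> \<real>\<^sub>\<ge>\<^sub>0"
  using state_positive_form[OF assms, of 1 n 0 n] by simp

text \<open>Reality of the form at the coefficients \<open>(1, 1)\<close> relates the imaginary parts, at \<open>(1, \<i>)\<close> the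
  real parts.\<close>

lemma state_hermitian:
  assumes "is_state \<phi>"
  shows "cnj (\<phi> (munit n m)) = \<phi> (munit m n)"
  using state_positive_form[OF assms, of 1 m 1 n] state_positive_form[OF assms, of 1 m \<i> n]
    state_diag_nonneg[OF assms, of m] state_diag_nonneg[OF assms, of n]
  by (simp add: complex_nonneg_Reals_iff complex_eq_iff)

text \<open>This weak form of the Cauchy-Schwarz inequality results from the coefficients \<open>(1, b)\<close>, where
  the phase \<open>b\<close> turns the off-diagonal element into a negative number.\<close>

lemma state_offdiag_le:
  assumes "is_state \<phi>"
  shows "2 * cmod (\<phi> (munit m n)) \<le> cmod (\<phi> (munit m m)) + cmod (\<phi> (munit n n))"
proof (cases "\<phi> (munit m n) = 0")
  case False
  define q where "q = \<phi> (munit m n)"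
  define b where "b = - (cnj q / of_real (cmod q))"
  have q: "cmod q \<noteq> 0" using False by (simp add: q_def)
  have bq: "b * q = - of_real (cmod q)"
    using q complex_norm_square[of q] by (simp add: b_def mult.commute power2_eq_square field_simps)
  have bb: "cnj b * b = 1"
    using q complex_norm_square[of q] by (simp add: b_def mult.commute power2_eq_square field_simps)
  have "cnj b * cnj q = - of_real (cmod q)"
    by (metis bq complex_cnj_complex_of_real complex_cnj_minus complex_cnj_mult)
  moreover have "\<phi> (munit n m) = cnj q"
    unfolding q_def by (rule state_hermitian[OF assms, symmetric])
  ultimately have "\<phi> (munit m m) - 2 * of_real (cmod q) + \<phi> (munit n n) \<in> \<real>\<^sub>\<ge>\<^sub>0"
    using state_positive_form[OF assms, of 1 m b n] bq bb by (simp add: q_def)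
  then show ?thesis
    using complex_Re_le_cmod[of "\<phi> (munit m m)"] complex_Re_le_cmod[of "\<phi> (munit n n)"]
    by (simp add: complex_nonneg_Reals_iff q_def)
qed simp

text \<open>Since \<open>op_trace\<close> is a bare \<open>suminf\<close>, the diagonal has to be shown summable before
  \<open>\<phi> 1 = 1\<close> can be read as a statement about its sum; a state is at most \<open>1\<close> on the projection
  \<open>\<Sum>n<N. munit n n\<close>, and this bounds the partial sums.\<close>

lemma normal_state_diag_sums:
  assumes "normal_state \<phi>"
  shows "(\<lambda>n. \<phi> (munit n n)) sums 1"
proof -
  obtain \<sigma> where st: "is_state \<phi>" and \<sigma>: "\<And>x. \<phi> x = op_trace (\<sigma> * x)"
    using assms by (auto simp: normal_state_def)
  have add: "\<phi> (x + y) = \<phi> x + \<phi> y" and sc: "\<phi> (c *\<^sub>O x) = c * \<phi> x" and one: "\<phi> 1 = 1"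
    and pos: "\<phi> (adj x * x) \<in> \<real>\<^sub>\<ge>\<^sub>0" for x y c
    using st by (auto simp: is_state_def)
  have zero: "\<phi> 0 = 0" using sc[of 0 0] by simp
  have "\<phi> (munit n n) = cinner (app \<sigma> (ket n)) (ket n)" for n
  proof -
    have "\<phi> (munit n n) = (\<Sum>k\<in>{n}. cinner (app (\<sigma> * munit n n) (ket k)) (ket k))"
      unfolding \<sigma> op_trace_def by (rule suminf_finite) (auto simp: scaleC_algebra app_scaleC cinner_linear)
    then show ?thesis by (simp add: app_scaleC cinner_linear)
  qed
  then have tr: "(\<Sum>n. \<phi> (munit n n)) = 1"
    using one \<sigma>[of 1] by (simp add: op_trace_def)
  define d where "d n = Re (\<phi> (munit n n))" for n
  have d: "\<phi> (munit n n) = of_real (d n)" and d0: "0 \<le> d n" for n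
    using state_diag_nonneg[OF st, of n] by (auto simp: d_def complex_nonneg_Reals_iff complex_eq_iff)
  have partial: "(\<Sum>n<N. d n) \<le> 1" for N
  proof -
    define Q where "Q = (\<Sum>n<N. munit n n)"
    have appQ: "app Q y = trunc N (coord y)" for y
      by (simp add: Q_def app_sum trunc_def)
    have "adj (1 - Q) * (1 - Q) = 1 - Q"
    proof (rule bop_eqI_form)
      fix y z
      show "cinner (app (adj (1 - Q) * (1 - Q)) y) z = cinner (app (1 - Q) y) z"
        unfolding app_simps(6) cinner_adj_left
        unfolding cinner_def by (rule arg_cong[where f = suminf]) (auto simp: appQ coord_trunc)
    qed
    then have "\<phi> (1 - Q) \<in> \<real>\<^sub>\<ge>\<^sub>0" using pos[of "1 - Q"] by simp
    moreover have "\<phi> (1 - Q) + \<phi> Q = 1" using add[of "1 - Q" Q] one by simp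
    moreover have "\<phi> Q = (\<Sum>n<N. \<phi> (munit n n))"
      unfolding Q_def by (induction N) (simp_all add: zero add)
    ultimately show ?thesis by (simp add: d complex_nonneg_Reals_iff complex_eq_iff)
  qed
  have "summable d" by (rule summableI_nonneg_bounded[OF d0 partial])
  then have "summable (\<lambda>n. \<phi> (munit n n))" unfolding d by (rule summable_of_real)
  then show ?thesis using tr by (simp add: sums_iff)
qed

section \<open>The transition operator with complete exchange\<close>

lemma coord_shift: "coord (app shift x) 0 = 0" "coord (app shift x) (Suc n) = coord x n"
  by (simp_all add: shift.rep_eq coord_shift_ell2)

lemma coord_adj_shift: "coord (app (adj shift) x) n = coord x (Suc n)"
proof -
  have "coord (app (adj shift) x) n = cinner x (app shift (ket n))"
    by (metis cinner_adj_left cinner_ket_right)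
  then show ?thesis by (simp add: shift_ket cinner_ket_right)
qed

lemma adj_shift_shift: "app (adj shift) (app shift x) = x"
  by (rule ell2_eqI) (simp add: coord_adj_shift coord_shift)

text \<open>Going through the adjoint reduces the action on a general vector to the action on basis
  vectors.\<close>

lemma coord_diag_op:
  assumes "bounded (range \<alpha>)"
  shows "coord (app (diag_op \<alpha>) x) n = \<alpha> n * coord x n"
proof -
  have "app (adj (diag_op \<alpha>)) (ket n) = cnj (\<alpha> n) *\<^sub>C ket n"
  proof (rule ell2_eqI)
    fix k
    have "coord (app (adj (diag_op \<alpha>)) (ket n)) k = cinner (ket n) (app (diag_op \<alpha>) (ket k))"
      by (metis cinner_adj_left cinner_ket_right)
    then show "coord (app (adj (diag_op \<alpha>)) (ket n)) k = coord (cnj (\<alpha> n) *\<^sub>C ket n) k"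
      by (simp add: diag_op_ket[OF assms] cinner_linear cinner_ket_left)
  qed
  then have "cinner x (app (adj (diag_op \<alpha>)) (ket n)) = \<alpha> n * coord x n"
    by (simp add: cinner_linear cinner_ket_right)
  then show ?thesis by (metis cinner_adj cinner_ket_right)
qed

lemma adj_adj: "adj (adj S) = S"
  by (rule adj_eqI) (rule cinner_adj_left)

lemma adj_scaleC_op: "adj (c *\<^sub>O S) = cnj c *\<^sub>O adj S"
  by (rule adj_eqI) (simp add: cinner_linear cinner_adj)

lemma adj_zero: "adj 0 = 0"
  by (rule adj_eqI) simp

locale exchange_model =
  fixes \<alpha> \<beta> :: "nat \<Rightarrow> complex" and \<psi> :: "complex^2^2 \<Rightarrow> complex"
    and l :: real and \<zeta> :: complex
  assumes \<alpha>0: "\<alpha> 0 = 1" and \<beta>0: "\<beta> 0 = 0"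
    and \<alpha>_pos: "\<And>n. n \<ge> 1 \<Longrightarrow> \<alpha> n = 0" and \<beta>_pos: "\<And>n. n \<ge> 1 \<Longrightarrow> \<beta> n = 1"
    and params: "has_parameters \<psi> l \<zeta>"
begin

abbreviation (input) "T \<equiv> transition \<alpha> \<beta> \<psi>"

definition w :: complex where "w = of_real (sqrt (l * (1 - l)))"

lemma l_bounds: "0 \<le> l" "l \<le> 1"
  using params by (auto simp: has_parameters_def)

lemma diag_\<alpha>: "diag_op \<alpha> = munit 0 0"
proof -
  have "range \<alpha> \<subseteq> {0, 1}"
    using \<alpha>0 \<alpha>_pos by (metis One_nat_def Suc_leI gr0I image_subset_iff insertCI)
  then have b: "bounded (range \<alpha>)" by (rule finite_imp_bounded[OF finite_subset]) simp
  show ?thesis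
    by (intro bop_eqI ell2_eqI) (simp add: coord_diag_op[OF b] \<alpha>0 \<alpha>_pos)
qed

lemma diag_\<beta>: "diag_op \<beta> = 1 - munit 0 0"
proof -
  have "range \<beta> \<subseteq> {0, 1}"
    using \<beta>0 \<beta>_pos by (metis One_nat_def Suc_leI gr0I image_subset_iff insertCI)
  then have b: "bounded (range \<beta>)" by (rule finite_imp_bounded[OF finite_subset]) simp
  show ?thesis
    by (intro bop_eqI ell2_eqI) (simp add: coord_diag_op[OF b] \<beta>0 \<beta>_pos)
qed

lemma u_op_eq: "u_op \<alpha> \<beta> = vector [vector [0, \<i> *\<^sub>O adj shift], vector [\<i> *\<^sub>O shift, munit 0 0]]"
proof -
  have "adj shift * munit 0 0 * shift = 0"
    by (intro bop_eqI ell2_eqI) (simp add: coord_shift coord_adj_shift app_scaleC)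
  moreover have "adj shift * (1 - munit 0 0) = adj shift"
    by (intro bop_eqI ell2_eqI) (simp add: coord_adj_shift)
  moreover have "(1 - munit 0 0) * shift = shift"
    by (intro bop_eqI ell2_eqI) (simp add: coord_shift)
  ultimately show ?thesis by (simp add: u_op_def Let_def diag_\<alpha> diag_\<beta>)
qed

lemma transition_eq:
  "T x = of_real l *\<^sub>O (adj shift * x * shift) +
    of_real (1 - l) *\<^sub>O (shift * x * adj shift + munit 0 0 * x * munit 0 0) +
    (- \<i> * \<zeta> * w) *\<^sub>O (adj shift * x * munit 0 0) + (\<i> * cnj \<zeta> * w) *\<^sub>O (munit 0 0 * x * shift)"
proof -
  have \<psi>: "\<psi> y = trace (rho l \<zeta> ** y)" for y using params by (simp add: has_parameters_def)
  have \<psi>s: "\<psi> (munit2 1 1) = of_real l" "\<psi> (munit2 1 2) = \<zeta> * w" "\<psi> (munit2 2 1) = cnj \<zeta> * w"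
    "\<psi> (munit2 2 2) = of_real (1 - l)"
    by (simp_all add: \<psi> trace_def matrix_matrix_mult_def sum_2 rho_def munit2_def w_def)
  show ?thesis
    unfolding transition_def P_map_def
    by (intro bop_eqI ell2_eqI)
      (simp add: sum_2 \<psi>s u_op_eq madj_def tensor_def matrix_matrix_mult_def mat_def
        adj_scaleC_op adj_adj adj_zero adj_munit app_scaleC scaleC_algebra app_add algebra_simps)
qed

text \<open>The form of \<open>T x\<close> evaluates \<open>x\<close> only at shifted vectors and at \<open>ket 0\<close>. It serves both sides of
  the duality: with \<open>x\<close> a matrix unit it yields the recursions, with \<open>y = z\<close> the action of
  \<open>T\<close> on vector states.\<close>

lemma transition_form:
  "cinner (app (T x) y) z =
    of_real l * cinner (app x (app shift y)) (app shift z) +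
    of_real (1 - l) * (cinner (app x (app (adj shift) y)) (app (adj shift) z) +
      coord y 0 * cnj (coord z 0) * cinner (app x (ket 0)) (ket 0)) +
    (- \<i> * \<zeta> * w) * coord y 0 * cinner (app x (ket 0)) (app shift z) +
    (\<i> * cnj \<zeta> * w) * cnj (coord z 0) * cinner (app x (app shift y)) (ket 0)"
  by (simp add: transition_eq cinner_linear cinner_adj_left cinner_adj[of shift] app_scaleC
      cinner_ket_right cinner_ket_left algebra_simps)

lemma T_munit_Suc_Suc:
  "T (munit (Suc m) (Suc n)) = of_real l *\<^sub>O munit m n +
    of_real (1 - l) *\<^sub>O munit (Suc (Suc m)) (Suc (Suc n))"
  by (rule bop_eqI_form)
    (simp add: transition_form cinner_linear cinner_ket_left coord_shift coord_adj_shift algebra_simps)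

lemma T_munit_0_Suc: "T (munit 0 (Suc k)) = of_real (1 - l) *\<^sub>O munit 1 (Suc (Suc k)) +
    (\<i> * cnj \<zeta> * w) *\<^sub>O munit 0 k"
  by (rule bop_eqI_form)
    (simp add: transition_form cinner_linear cinner_ket_left coord_shift coord_adj_shift algebra_simps)

text \<open>The three-term recursion along a diagonal says that the current \<open>J\<close> is conserved, and matrix
  elements of a normal state vanish at infinity, so the current is zero.\<close>

lemma invariant_matrix_step:
  assumes norm: "normal_state \<phi>" and inv: "invariant_under T \<phi>"
  shows "of_real (1 - l) * \<phi> (munit (Suc n) (Suc n + k)) = of_real l * \<phi> (munit n (n + k))"
proof -
  have st: "is_state \<phi>" using norm by (simp add: normal_state_def)
  have T: "\<phi> (T x) = \<phi> x" for x
    using inv unfolding invariant_under_def by (metis comp_apply)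
  define g where "g n = \<phi> (munit n (n + k))" for n
  define J where "J n = of_real (1 - l) * g (Suc n) - of_real l * g n" for n
  have "J (Suc n) = J n" for n
  proof -
    have "g (Suc n) = of_real l * g n + of_real (1 - l) * g (Suc (Suc n))"
      using T[of "munit (Suc n) (Suc (n + k))"] st
      by (simp add: g_def T_munit_Suc_Suc is_state_def)
    then show ?thesis by (simp add: J_def algebra_simps)
  qed
  then have J_const: "J n = J 0" for n by (induction n) simp_all
  have d_lim: "(\<lambda>n. cmod (\<phi> (munit n n))) \<longlonglongrightarrow> 0"
    using normal_state_diag_sums[OF norm]
    by (intro tendsto_norm_zero summable_LIMSEQ_zero) (simp add: sums_iff)
  have g_lim: "g \<longlonglongrightarrow> 0"
  proof (rule Lim_null_comparison)
    have "cmod (g n) \<le> cmod (\<phi> (munit n n)) + cmod (\<phi> (munit (n + k) (n + k)))" for n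
      using state_offdiag_le[OF st, of n "n + k"] norm_ge_zero[of "g n"] unfolding g_def by linarith
    then show "\<forall>\<^sub>F n in sequentially.
        norm (g n) \<le> cmod (\<phi> (munit n n)) + cmod (\<phi> (munit (n + k) (n + k)))"
      by simp
    show "(\<lambda>n. cmod (\<phi> (munit n n)) + cmod (\<phi> (munit (n + k) (n + k)))) \<longlonglongrightarrow> 0"
      using tendsto_add[OF d_lim LIMSEQ_ignore_initial_segment[OF d_lim, of k]] by simp
  qed
  have "J \<longlonglongrightarrow> of_real (1 - l) * 0 - of_real l * 0"
    unfolding J_def by (intro tendsto_intros g_lim LIMSEQ_Suc)
  moreover have "J = (\<lambda>_. J 0)" using J_const by (rule ext)
  then have "J \<longlonglongrightarrow> J 0" by (metis tendsto_const)
  ultimately have "J 0 = 0" using LIMSEQ_unique by fastforce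
  then show ?thesis using J_const[of n] by (simp add: J_def g_def)
qed

text \<open>Summing the step over the main diagonal and using that the trace is \<open>1\<close>.\<close>

lemma invariant_ground_weight:
  assumes norm: "normal_state \<phi>" and inv: "invariant_under T \<phi>"
  shows "of_real (1 - l) * \<phi> (munit 0 0) = of_real (1 - 2 * l)"
proof -
  have sums: "(\<lambda>n. \<phi> (munit n n)) sums 1" by (rule normal_state_diag_sums[OF norm])
  then have "(\<lambda>n. \<phi> (munit (Suc n) (Suc n))) sums (1 - \<phi> (munit 0 0))"
    by (subst sums_Suc_iff) simp
  then have "(\<lambda>n. of_real l * \<phi> (munit n n)) sums (of_real (1 - l) * (1 - \<phi> (munit 0 0)))"
    using invariant_matrix_step[OF norm inv, of _ 0]
    by (auto dest: sums_mult[of _ _ "of_real (1 - l)"])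
  from sums_unique2[OF this sums_mult[OF sums]] show ?thesis by (simp add: algebra_simps)
qed

lemma invariant_imp_less_half:
  assumes norm: "normal_state \<phi>" and inv: "invariant_under T \<phi>"
  shows "l < 1 / 2"
proof (rule ccontr)
  assume half: "\<not> l < 1 / 2"
  have st: "is_state \<phi>" using norm by (simp add: normal_state_def)
  define d where "d = Re (\<phi> (munit 0 0))"
  have "(1 - l) * d = 1 - 2 * l"
    using arg_cong[OF invariant_ground_weight[OF norm inv], of Re] by (simp add: d_def)
  moreover have "0 \<le> (1 - l) * d"
    using state_diag_nonneg[OF st, of 0] l_bounds by (simp add: d_def complex_nonneg_Reals_iff)
  ultimately have l: "l = 1 / 2" using half by simp
  have "\<phi> (munit n n) = 0" for n
  proof (induction n)
    case 0 show ?case using invariant_ground_weight[OF norm inv] by (simp add: l)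
  next
    case (Suc n) then show ?case using invariant_matrix_step[OF norm inv, of n 0] by (simp add: l)
  qed
  then show False using normal_state_diag_sums[OF norm] sums_unique2[OF sums_zero] by fastforce
qed

end

locale subcritical_exchange_model = exchange_model +
  assumes half: "l < 1 / 2"
begin

definition r :: real where "r = l / (1 - l)"

text \<open>The ratio of the values of an invariant state at \<open>munit 0 (k + 1)\<close> and \<open>munit 0 k\<close>, and also the
  eigenvalue of the backward shift at the vector \<open>coherent c\<close> from which the invariant state is
  built.\<close>

definition c :: complex where "c = \<i> * cnj \<zeta> * of_real (sqrt r)"

lemma r_bounds: "0 \<le> r" "r < 1"
  using half l_bounds by (auto simp: r_def divide_simps)

lemma l_eq: "l = (1 - l) * r"
  using half by (simp add: r_def)

lemma w_eq: "w = of_real ((1 - l) * sqrt r)"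
proof -
  have "l * (1 - l) = (1 - l)\<^sup>2 * r"
    using l_eq by (metis mult.commute mult.left_commute power2_eq_square)
  then show ?thesis using half by (simp add: w_def real_sqrt_mult)
qed

lemma c_eq: "\<i> * cnj \<zeta> * w = of_real (1 - l) * c" "- \<i> * \<zeta> * w = of_real (1 - l) * cnj c"
  by (simp_all add: w_eq c_def)

lemma cmod_c: "(cmod c)\<^sup>2 \<le> r"
proof -
  have "(cmod c)\<^sup>2 = (cmod \<zeta>)\<^sup>2 * r"
    using r_bounds by (simp add: c_def norm_mult power_mult_distrib)
  also have "\<dots> \<le> 1 * r"
    using params r_bounds by (intro mult_right_mono) (auto simp: has_parameters_def power_le_one)
  finally show ?thesis by simp
qed

text \<open>Down a diagonal the ratio is \<open>r\<close>. For the initial values, the equation at \<open>munit 0 (k + 1)\<close>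
  contains \<open>munit 1 (k + 2)\<close>; the step along that diagonal removes it and leaves the ratio \<open>c\<close>.\<close>

lemma invariant_matrix_elements:
  assumes norm: "normal_state \<phi>" and inv: "invariant_under T \<phi>"
  shows "\<phi> (munit n (n + k)) = of_real ((1 - 2 * l) / (1 - l)) * c ^ k * of_real r ^ n"
proof -
  have st: "is_state \<phi>" using norm by (simp add: normal_state_def)
  have T: "\<phi> (T x) = \<phi> x" for x
    using inv unfolding invariant_under_def by (metis comp_apply)
  have l1: "of_real (1 - l) \<noteq> (0 :: complex)" 
    unfolding of_real_eq_0_iff using half by simp
  have step: "\<phi> (munit (Suc n) (Suc n + k)) = of_real r * \<phi> (munit n (n + k))" for n k
    using invariant_matrix_step[OF norm inv, of n k] l1 by (simp add: r_def field_simps)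
  have row: "\<phi> (munit 0 k) = of_real ((1 - 2 * l) / (1 - l)) * c ^ k" for k
  proof (induction k)
    case 0
    show ?case using invariant_ground_weight[OF norm inv] l1 by (simp add: field_simps)
  next
    case (Suc k)
    have "\<phi> (munit 0 (Suc k)) = of_real (1 - l) * \<phi> (munit 1 (Suc (Suc k))) +
        of_real (1 - l) * c * \<phi> (munit 0 k)"
      using T[of "munit 0 (Suc k)"] st unfolding T_munit_0_Suc c_eq by (simp add: is_state_def)
    also have "of_real (1 - l) * \<phi> (munit 1 (Suc (Suc k))) = of_real l * \<phi> (munit 0 (Suc k))"
      using invariant_matrix_step[OF norm inv, of 0 "Suc k"] by simp
    finally have "of_real (1 - l) * \<phi> (munit 0 (Suc k)) = of_real (1 - l) * (c * \<phi> (munit 0 k))"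
      by (simp add: algebra_simps)
    then have "\<phi> (munit 0 (Suc k)) = c * \<phi> (munit 0 k)" using l1 by simp
    then show ?case using Suc by simp
  qed
  show ?thesis
  proof (induction n)
    case 0 show ?case using row by simp
  next
    case (Suc n) then show ?case using step[of n k] by simp
  qed
qed

end

section \<open>Eigenvectors of the backward shift\<close>

definition coherent :: "complex \<Rightarrow> ell2"
  where "coherent c = Abs_ell2 (\<lambda>n. c ^ n)"

lemma coherent_norm_sums:
  assumes "cmod c < 1"
  shows "(\<lambda>n. (cmod (c ^ n))\<^sup>2) sums (1 / (1 - (cmod c)\<^sup>2))"
proof -
  have "(\<lambda>n. ((cmod c)\<^sup>2) ^ n) sums (1 / (1 - (cmod c)\<^sup>2))"
    by (rule geometric_sums) (use assms in \<open>simp add: power_less_one_iff\<close>)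
  then show ?thesis by (simp add: norm_power power_mult [symmetric] mult.commute)
qed

context
  fixes c :: complex
  assumes c: "cmod c < 1"
begin

lemma coord_coherent: "coord (coherent c) n = c ^ n"
  using coherent_norm_sums[OF c] by (simp add: coherent_def Abs_ell2_inverse sums_iff)

lemma norm_coherent: "(norm (coherent c))\<^sup>2 = 1 / (1 - (cmod c)\<^sup>2)"
  using sums_unique2[OF norm_sq_sums[of "coherent c"]] coherent_norm_sums[OF c] 
  by (simp add: coord_coherent)

lemma adj_shift_coherent: "app (adj shift) (coherent c) = c *\<^sub>C coherent c"
  by (rule ell2_eqI) (simp add: coord_adj_shift coord_coherent)

lemma coherent_split: "coherent c = ket 0 + c *\<^sub>C app shift (coherent c)"
proof (rule ell2_eqI)
  fix n show "coord (coherent c) n = coord (ket 0 + c *\<^sub>C app shift (coherent c)) n"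
    by (cases n) (simp_all add: coord_coherent coord_shift)
qed

end

section \<open>The invariant state\<close>

context subcritical_exchange_model
begin

lemma c_less_one: "cmod c < 1"
  using cmod_c r_bounds by (metis abs_norm_cancel abs_square_less_1 order_le_less_trans)

definition \<xi> :: "nat \<Rightarrow> ell2" where "\<xi> j = (app shift ^^ j) (coherent c)"
definition \<omega> :: "nat \<Rightarrow> bop \<Rightarrow> complex" where "\<omega> j x = cinner (app x (\<xi> j)) (\<xi> j)"
definition \<kappa> :: real where "\<kappa> = r - (cmod c)\<^sup>2"

lemma \<xi>_simps: "\<xi> 0 = coherent c" "app shift (\<xi> j) = \<xi> (Suc j)"
  "app shift (coherent c) = \<xi> (Suc 0)"
  by (simp_all add: \<xi>_def)

lemma adj_shift_\<xi>: "app (adj shift) (\<xi> (Suc j)) = \<xi> j" "coord (\<xi> (Suc j)) 0 = 0"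
  by (simp_all add: adj_shift_shift coord_shift flip: \<xi>_simps(2))

lemma norm_\<xi>: "(norm (\<xi> j))\<^sup>2 = 1 / (1 - (cmod c)\<^sup>2)"
proof (induction j)
  case 0 show ?case using norm_coherent[OF c_less_one] by (simp add: \<xi>_simps)
next
  case (Suc j) then show ?case
    by (simp add: shift.rep_eq norm_shift_ell2 flip: \<xi>_simps(2))
qed

text \<open>For \<open>j > 0\<close> the vector \<open>\<xi> j\<close> is orthogonal to \<open>ket 0\<close>, so the boundary terms disappear.\<close>

lemma \<omega>_transition_Suc: "\<omega> (Suc j) (T x) = of_real l * \<omega> (Suc (Suc j)) x + of_real (1 - l) * \<omega> j x"
  by (simp add: \<omega>_def transition_form adj_shift_\<xi> \<xi>_simps(2))

text \<open>The boundary terms are exactly the mixed terms in the expansion of \<open>\<omega> 0 x\<close> along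
  \<open>\<xi> 0 = ket 0 + c \<xi> 1\<close>; this is what dictates the value of \<open>c\<close>.\<close>

lemma \<omega>_transition_0:
  "\<omega> 0 (T x) = of_real l * \<omega> (Suc 0) x +
    of_real (1 - l) * (of_real (1 + (cmod c)\<^sup>2) * \<omega> 0 x - of_real ((cmod c)\<^sup>2) * \<omega> (Suc 0) x)"
proof -
  have cc: "of_real ((cmod c)\<^sup>2) = c * cnj c" by (rule complex_norm_square)
  define p where "p = cinner (app x (ket 0)) (\<xi> (Suc 0))"
  define q where "q = cinner (app x (\<xi> (Suc 0))) (ket 0)"
  have "\<omega> 0 x = cinner (app x (ket 0 + c *\<^sub>C \<xi> (Suc 0))) (ket 0 + c *\<^sub>C \<xi> (Suc 0))"
    unfolding \<omega>_def \<xi>_simps(1) using coherent_split[OF c_less_one]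
    by (metis \<xi>_simps(3))
  then have split: "\<omega> 0 x = cinner (app x (ket 0)) (ket 0) + cnj c * p + c * q + c * cnj c * \<omega> (Suc 0) x"
    by (simp add: app_add app_scaleC cinner_linear p_def q_def \<omega>_def algebra_simps)
  have "\<omega> 0 (T x) = of_real l * \<omega> (Suc 0) x + of_real (1 - l) * (c * cnj c * \<omega> 0 x +
      cinner (app x (ket 0)) (ket 0)) + of_real (1 - l) * cnj c * p + of_real (1 - l) * c * q"
    unfolding \<omega>_def transition_form c_eq
    by (simp add: \<xi>_simps adj_shift_coherent[OF c_less_one] coord_coherent[OF c_less_one]
        app_scaleC cinner_linear p_def q_def algebra_simps)
  then show ?thesis unfolding of_real_add of_real_1 cc
    by (simp add: split algebra_simps)
qed

definition tail :: "bop \<Rightarrow> complex" where "tail x = (\<Sum>j. of_real r ^ j * \<omega> (Suc j) x)"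
definition stationary :: "bop \<Rightarrow> complex"
  where "stationary x = of_real (1 - r) * (\<omega> 0 x + of_real \<kappa> * tail x)"

lemma tail_sums: "(\<lambda>j. of_real r ^ j * \<omega> (Suc j) x) sums tail x"
  unfolding tail_def
proof (rule summable_sums)
  obtain K where K: "\<And>y. norm (app x y) \<le> norm y * K"
    using norm_app_bounded by blast
  define B where "B = K * (1 / (1 - (cmod c)\<^sup>2))"
  have bound: "cmod (\<omega> j x) \<le> B" for j
  proof -
    have "cmod (\<omega> j x) \<le> norm (app x (\<xi> j)) * norm (\<xi> j)"
      unfolding \<omega>_def by (rule cinner_Cauchy_Schwarz)
    also have "\<dots> \<le> (norm (\<xi> j) * K) * norm (\<xi> j)" by (rule mult_right_mono[OF K]) simp
    also have "\<dots> = B" unfolding B_def norm_\<xi>[of j, symmetric] by (simp add: power2_eq_square)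
    finally show ?thesis .
  qed
  show "summable (\<lambda>j. of_real r ^ j * \<omega> (Suc j) x)"
  proof (rule summable_comparison_test')
    show "summable (\<lambda>j. r ^ j * B)" using r_bounds by (intro summable_mult2 summable_geometric) simp
    show "norm (of_real r ^ j * \<omega> (Suc j) x) \<le> r ^ j * B" for j
      using r_bounds by (simp add: norm_mult norm_power mult_left_mono bound)
  qed
qed

text \<open>The upward part of \<open>\<omega>_transition_Suc\<close> carries \<open>l = (1 - l) r\<close>, which raises the power of
  \<open>r\<close> along with the index, so that both parts are shifted copies of the series \<open>tail x\<close>.\<close>

lemma tail_transition:
  "tail (T x) = of_real (1 - l) * (\<omega> 0 x - \<omega> (Suc 0) x + of_real (1 + r) * tail x)"
proof -
  have up: "(\<lambda>j. of_real r ^ Suc j * \<omega> (Suc (Suc j)) x) sums (tail x - \<omega> (Suc 0) x)"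
    using tail_sums[of x] by (subst sums_Suc_iff) simp
  have "(\<lambda>j. of_real r ^ Suc j * \<omega> (Suc j) x) sums (of_real r * tail x)"
    using sums_mult[OF tail_sums[of x], of "of_real r"] by (simp add: mult.assoc)
  then have down: "(\<lambda>j. of_real r ^ j * \<omega> j x) sums (of_real r * tail x + \<omega> 0 x)"
    by (subst (asm) sums_Suc_iff) simp
  have "of_real r ^ j * \<omega> (Suc j) (T x) = of_real (1 - l) *
      (of_real r ^ Suc j * \<omega> (Suc (Suc j)) x + of_real r ^ j * \<omega> j x)" for j
    unfolding \<omega>_transition_Suc by (subst (1) l_eq) (simp add: algebra_simps)
  then have "(\<lambda>j. of_real r ^ j * \<omega> (Suc j) (T x)) sums
      (of_real (1 - l) * ((tail x - \<omega> (Suc 0) x) + (of_real r * tail x + \<omega> 0 x)))"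
    using sums_mult[OF sums_add[OF up down], of "of_real (1 - l)"] by simp
  from sums_unique2[OF tail_sums this] show ?thesis by (simp add: algebra_simps)
qed

text \<open>In the combination \<open>\<omega> 0 + \<kappa> tail\<close> the terms with \<open>\<omega> 1\<close> cancel, and the
  rest is multiplied by \<open>(1 - l) (1 + r) = 1\<close>.\<close>

lemma stationary_invariant: "invariant_under T stationary"
proof -
  have one: "of_real (1 - l) * of_real (1 + r) = (1 :: complex)"
    using l_eq unfolding of_real_mult[symmetric] by (simp add: algebra_simps)
  have \<omega>0: "\<omega> 0 (T x) = of_real (1 - l) *
      (of_real \<kappa> * \<omega> (Suc 0) x + of_real (1 + (cmod c)\<^sup>2) * \<omega> 0 x)" for x
    unfolding \<omega>_transition_0 by (subst (1) l_eq) (simp add: \<kappa>_def algebra_simps)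
  have "\<omega> 0 (T x) + of_real \<kappa> * tail (T x) =
      (of_real (1 - l) * of_real (1 + r)) * (\<omega> 0 x + of_real \<kappa> * tail x)" for x
    unfolding \<omega>0 tail_transition by (simp add: \<kappa>_def algebra_simps)
  then have "stationary (T x) = stationary x" for x
    unfolding stationary_def one by simp
  then show ?thesis by (simp add: invariant_under_def fun_eq_iff)
qed

lemma stationary_normal: "normal_state stationary"
proof (rule normal_state_mixture)
  \<comment> \<open>The weights are absorbed into the norms of the vectors.\<close>
  define p where "p j = (case j of 0 \<Rightarrow> 1 - r | Suc i \<Rightarrow> (1 - r) * \<kappa> * r ^ i)" for j
  have p0: "0 \<le> p j" for j
    using r_bounds cmod_c by (auto simp: p_def \<kappa>_def split: nat.split)
  define \<eta> where "\<eta> j = of_real (sqrt (p j)) *\<^sub>C \<xi> j" for j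
  have c1: "(cmod c)\<^sup>2 < 1" using cmod_c r_bounds by simp
  have "(\<lambda>i. (1 - r) * \<kappa> * r ^ i) sums ((1 - r) * \<kappa> * (1 / (1 - r)))"
    by (intro sums_mult geometric_sums) (use r_bounds in simp)
  then have "(\<lambda>i. p (Suc i)) sums \<kappa>" using r_bounds by (simp add: p_def)
  then have "p sums (\<kappa> + (1 - r))" by (subst (asm) sums_Suc_iff) (simp add: p_def)
  then have "(\<lambda>j. p j * (1 / (1 - (cmod c)\<^sup>2))) sums ((\<kappa> + (1 - r)) * (1 / (1 - (cmod c)\<^sup>2)))"
    by (rule sums_mult2)
  moreover have "(\<kappa> + (1 - r)) * (1 / (1 - (cmod c)\<^sup>2)) = 1" using c1 by (simp add: \<kappa>_def)
  moreover have "(norm (\<eta> j))\<^sup>2 = p j * (1 / (1 - (cmod c)\<^sup>2))" for j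
    using p0[of j] norm_\<xi>[of j] by (simp add: \<eta>_def norm_scaleC power_mult_distrib)
  ultimately show "(\<lambda>j. (norm (\<eta> j))\<^sup>2) sums 1" by (simp only:)
  fix x
  have \<eta>: "cinner (app x (\<eta> j)) (\<eta> j) = of_real (p j) * \<omega> j x" for j
    using p0[of j] by (simp add: \<eta>_def app_scaleC cinner_linear \<omega>_def flip: mult.assoc of_real_mult)
  have "(\<lambda>i. of_real (p (Suc i)) * \<omega> (Suc i) x) sums (of_real ((1 - r) * \<kappa>) * tail x)"
    using sums_mult[OF tail_sums[of x], of "of_real ((1 - r) * \<kappa>)"] by (simp add: p_def mult.assoc)
  then have "(\<lambda>j. of_real (p j) * \<omega> j x) sums
      (of_real ((1 - r) * \<kappa>) * tail x + of_real (p 0) * \<omega> 0 x)"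
    by (subst (asm) sums_Suc_iff)
  then show "(\<lambda>j. cinner (app x (\<eta> j)) (\<eta> j)) sums stationary x"
    by (simp add: \<eta> p_def stationary_def algebra_simps)
qed

end

theorem theorem5p5:
  fixes \<alpha> \<beta> :: "nat \<Rightarrow> complex" and \<psi> :: "complex^2^2 \<Rightarrow> complex"
    and l :: real and \<zeta> :: complex
  assumes "\<alpha> 0 = 1" and "\<beta> 0 = 0"
    and "\<And>n. n \<ge> 1 \<Longrightarrow> \<alpha> n = 0" and "\<And>n. n \<ge> 1 \<Longrightarrow> \<beta> n = 1"
    and "is_state2 \<psi>" and "has_parameters \<psi> l \<zeta>"
  shows "((\<exists>\<phi>. normal_state \<phi> \<and> invariant_under (transition \<alpha> \<beta> \<psi>) \<phi>) \<longleftrightarrow> l < 1 / 2) \<and>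
    (l < 1 / 2 \<longrightarrow>
      (\<forall>\<phi>. normal_state \<phi> \<and> invariant_under (transition \<alpha> \<beta> \<psi>) \<phi> \<longrightarrow>
        (\<forall>n k. cnj (\<phi> (munit (n + k) n)) = \<phi> (munit n (n + k)) \<and>
          \<phi> (munit n (n + k)) =
            of_real ((1 - 2 * l) / (1 - l)) *
            (\<i> * cnj \<zeta> * of_real (sqrt (l / (1 - l)))) ^ k *
            of_real (l / (1 - l)) ^ n)))"
proof -
  interpret exchange_model \<alpha> \<beta> \<psi> l \<zeta>
    by unfold_locales (use assms in auto)
  show ?thesis
  proof (cases "l < 1 / 2")
    case False
    then show ?thesis using invariant_imp_less_half by blast
  next
    case True
    interpret subcritical_exchange_model \<alpha> \<beta> \<psi> l \<zeta>
      by unfold_locales (rule True)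
    show ?thesis
    proof (intro conjI impI iffI allI)
      show "\<exists>\<phi>. normal_state \<phi> \<and> invariant_under T \<phi>"
        using stationary_normal stationary_invariant by blast
    next
      fix \<phi> n k
      assume \<phi>: "normal_state \<phi> \<and> invariant_under T \<phi>"
      then show "cnj (\<phi> (munit (n + k) n)) = \<phi> (munit n (n + k))"
        by (intro state_hermitian) (simp add: normal_state_def)
      show "\<phi> (munit n (n + k)) = of_real ((1 - 2 * l) / (1 - l)) *
          (\<i> * cnj \<zeta> * of_real (sqrt (l / (1 - l)))) ^ k * of_real (l / (1 - l)) ^ n"
        using \<phi> invariant_matrix_elements[of \<phi> n k] unfolding c_def r_def by blast
    qed (rule True)
  qed
qed

end
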